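(* Fix integers $r \ge 2$ and $k \ge 1$. Then $$h(n,k,K_3) \leq h(n,k,W_{2r})\leq h(n,k,K_3)+o(n^2)$$ as $n \to \infty$. In particular, for $n$ sufficiently large (in terms of $r$ and $k$), we have $h(n,k,W_{2r})=\Theta(n^2/k^2)$, with absolute implicit constants.
   Context: All graphs are finite, undirected and simple. A graph is $H$-free if it does not contain $H$ as a (not necessarily induced) subgraph. For a graph $G$ and a positive integer $k$, $h(G,k)$ is the minimum number of edges that can be deleted from $G$ so that the remaining graph is $k$-colorable. For a graph $H$ and positive integers $n,k$, $h(n,k,H)$ is the maximum of $h(G,k)$ over all $H$-free graphs $G$ on $n$ vertices. The wheel $W_\ell$ is the graph on $\ell+1$ vertices consisting of an $\ell$-cycle and an additional vertex adjacent to all vertices of the $\ell$-cycle. $K_3$ is the triangle. *)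

theory Defs
  imports Complex_Main "HOL-Library.Landau_Symbols"
begin

record 'a ugraph =
  vertex_set :: "'a set"
  edge_set :: "'a set set"

definition simple_graph :: "'a ugraph \<Rightarrow> bool" where
  "simple_graph G \<longleftrightarrow>
     finite (vertex_set G) \<and> (\<forall>e\<in>edge_set G. e \<subseteq> vertex_set G \<and> card e = 2)"

text \<open>Containment as a subgraph, not necessarily induced.\<close>

definition contains_graph :: "'a ugraph \<Rightarrow> 'b ugraph \<Rightarrow> bool" where
  "contains_graph G H \<longleftrightarrow>
     (\<exists>f. inj_on f (vertex_set H) \<and> f ` vertex_set H \<subseteq> vertex_set G \<and>
          (\<forall>e\<in>edge_set H. f ` e \<in> edge_set G))"

definition H_free :: "'b ugraph \<Rightarrow> 'a ugraph \<Rightarrow> bool" where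
  "H_free H G \<longleftrightarrow> \<not> contains_graph G H"

definition colorable :: "nat \<Rightarrow> 'a ugraph \<Rightarrow> bool" where
  "colorable k G \<longleftrightarrow>
     (\<exists>c. (\<forall>v\<in>vertex_set G. c v < k) \<and>
          (\<forall>u v. {u, v} \<in> edge_set G \<longrightarrow> c u \<noteq> c v))"

definition delete_edges :: "'a ugraph \<Rightarrow> 'a set set \<Rightarrow> 'a ugraph" where
  "delete_edges G D = \<lparr>vertex_set = vertex_set G, edge_set = edge_set G - D\<rparr>"

definition h_graph :: "'a ugraph \<Rightarrow> nat \<Rightarrow> nat" where
  "h_graph G k = Min {card D | D. D \<subseteq> edge_set G \<and> colorable k (delete_edges G D)}"

text \<open>Every graph on n vertices is isomorphic to one whose vertices are natural numbers,
  so it suffices to maximise over those.\<close>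

definition h_max :: "nat \<Rightarrow> nat \<Rightarrow> 'b ugraph \<Rightarrow> nat" where
  "h_max n k H =
     Max {h_graph G k | G :: nat ugraph.
            simple_graph G \<and> card (vertex_set G) = n \<and> H_free H G}"

definition complete_graph :: "nat \<Rightarrow> nat ugraph" where
  "complete_graph t = \<lparr>vertex_set = {..<t}, edge_set = {e. e \<subseteq> {..<t} \<and> card e = 2}\<rparr>"

text \<open>The cycle has vertices 0, ..., l - 1 and the hub is the vertex l; this is the wheel
  when l is at least 3.\<close>

definition wheel :: "nat \<Rightarrow> nat ugraph" where
  "wheel l =
     \<lparr>vertex_set = {..l},
      edge_set = {{i, (i + 1) mod l} | i. i < l} \<union> {{i, l} | i. i < l}\<rparr>"

text \<open>The minimum and the maximum above are taken over finite nonempty sets.\<close>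

lemma finite_edge_set: "simple_graph G \<Longrightarrow> finite (edge_set G)"
  unfolding simple_graph_def by (meson Pow_iff finite_Pow_iff finite_subset subsetI)

lemma h_graph_wf:
  assumes "simple_graph G" "k \<ge> 1"
  defines "S \<equiv> {card D | D. D \<subseteq> edge_set G \<and> colorable k (delete_edges G D)}"
  shows "finite S" and "card (edge_set G) \<in> S"
proof -
  have "S \<subseteq> card ` Pow (edge_set G)" by (auto simp: S_def)
  then show "finite S"
    using finite_edge_set[OF assms(1)] by (meson finite_Pow_iff finite_imageI finite_subset)
  have "colorable k (delete_edges G (edge_set G))"
    using assms(2) unfolding colorable_def delete_edges_def
    by (intro exI[of _ "\<lambda>_. 0"]) auto
  then show "card (edge_set G) \<in> S" by (auto simp: S_def)
qed

lemma h_max_wf: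
  fixes H :: "'b ugraph" and n k :: nat
  assumes "k \<ge> 1" "edge_set H \<noteq> {}"
  defines "S \<equiv> {h_graph G k | G :: nat ugraph.
                  simple_graph G \<and> card (vertex_set G) = n \<and> H_free H G}"
  shows "finite S" and "S \<noteq> {}"
proof -
  have "h_graph G k \<le> n choose 2"
    if G: "simple_graph G" "card (vertex_set G) = n" for G :: "nat ugraph"
  proof -
    have "h_graph G k \<le> card (edge_set G)"
      unfolding h_graph_def by (intro Min_le h_graph_wf G assms)
    also have "\<dots> \<le> card {e. e \<subseteq> vertex_set G \<and> card e = 2}"
      using G by (intro card_mono) (auto simp: simple_graph_def)
    also have "\<dots> = n choose 2"
      using G n_subsets[of "vertex_set G" 2] by (auto simp: simple_graph_def)
    finally show ?thesis .
  qed
  then have "S \<subseteq> {..n choose 2}" by (auto simp: S_def)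
  then show "finite S" using finite_subset by blast
  define G0 :: "nat ugraph" where "G0 = \<lparr>vertex_set = {..<n}, edge_set = {}\<rparr>"
  have "simple_graph G0 \<and> card (vertex_set G0) = n \<and> H_free H G0"
    using assms(2) by (auto simp: G0_def simple_graph_def H_free_def contains_graph_def)
  then show "S \<noteq> {}" by (auto simp: S_def)
qed

lemma simple_graph_complete_graph: "simple_graph (complete_graph t)"
  by (auto simp: simple_graph_def complete_graph_def)

lemma simple_graph_wheel:
  assumes "l \<ge> 3"
  shows "simple_graph (wheel l)"
proof -
  have "i \<noteq> (i + 1) mod l" "(i + 1) mod l < l" if "i < l" for i
    using assms that by (cases "i + 1 = l"; simp)+
  then show ?thesis
    by (fastforce simp: simple_graph_def wheel_def card_2_iff less_imp_le)
qed

end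

(* A wheel of even order 2r is a vertex joined to a cycle contained in the biclique K(r,r). So in a graph without
   this wheel all neighbourhoods are free of K(r,r), and Jensen's inequality (Kovari-Sos-Turan) gives o(n^3)
   triangles. No removal lemma is needed: a random sample of m vertices, m constant, is with high probability
   triangle-free, and its optimal k-colouring is on average not better (up to epsilon) than that of the whole
   graph. Blowing up a triangle-free sample to n vertices hence gives a triangle-free graph that is almost as
   far from being k-colourable.

   The sampling statement is proved by an energy increment. Let c be an optimal colouring of the sample and
   classify vertices by their adjacency to s random sample vertices. Averaging the colour classes of c over the
   sample vertices of each type gives a fractional colouring that depends on the type only; for most s < S it
   costs hardly more than c, since otherwise the L2-energy of the averages would exceed 1. Such a colouring
   extends to all vertices of the graph, with a cost controlled by second moments, and fractional colourings can
   be rounded one vertex at a time.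

   For the order of magnitude, colour by random neighbourhoods for the upper bound; for the lower bound take
   the points of F_q^3, q a power of 2 between 16k and 32k, with all lines in the directions (1, y, y^2), and put a random complete
   bipartite graph on each line. *)
theory Submission
  imports Defs "HOL-Library.FuncSet" "HOL-Library.Z2" "HOL-Analysis.Convex" "HOL-Algebra.Algebraic_Closure_Type"
begin

section \<open>Averages over finite sets\<close>

text \<open>The optimal colouring \<open>c\<close> is chosen after the sample, so no concentration
  estimate applies to \<open>c\<close> itself. Averaging compresses it to a table of k * 2^s numbers
  in [0, 1], indexed by colours and types. The cost of a table is a combination, with coefficients
  in [0, 1], of edge densities between types, and these do not involve \<open>c\<close>: their
  deviations are small for all colourings at once. The vertices defining the types are drawn from
  the sample itself, where \<open>c\<close> lives; this freezes at most s sample positions, which a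
  second moment bound tolerates.

  Probabilities are averages over finite function spaces, so samples are drawn with replacement;
  repeated vertices are nonadjacent twins and do no harm. Edges are counted as ordered pairs, whence
  the factors 2 between densities and \<open>h_graph\<close>.

  In the lower bound a line has q > 16k points, so every k-colouring repeats colours often on it.
  Random splitting fails to separate enough of these repetitions with probability exponentially
  small in the number q^4 of flags, which beats the k^(q^3) colourings. Powers of 2 provide a field
  size within a factor 2 of any target.\<close>

definition mean :: "'a set \<Rightarrow> ('a \<Rightarrow> real) \<Rightarrow> real" where
  "mean A f = sum f A / real (card A)"

lemma mean_mono: "(\<And>x. x \<in> A \<Longrightarrow> f x \<le> g x) \<Longrightarrow> mean A f \<le> mean A g"
  unfolding mean_def by (intro divide_right_mono sum_mono) auto

lemma mean_cong: "(\<And>x. x \<in> A \<Longrightarrow> f x = g x) \<Longrightarrow> mean A f = mean A g"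
  unfolding mean_def by (auto intro: sum.cong)

lemma mean_add: "mean A (\<lambda>x. f x + g x) = mean A f + mean A g"
  unfolding mean_def by (simp add: sum.distrib add_divide_distrib)

lemma mean_diff: "mean A (\<lambda>x. f x - g x) = mean A f - mean A g"
  unfolding mean_def by (simp add: sum_subtractf diff_divide_distrib)

lemma mean_cmult: "mean A (\<lambda>x. c * f x) = c * mean A f"
  unfolding mean_def by (simp add: sum_distrib_left)

lemma mean_multc: "mean A (\<lambda>x. f x * c) = mean A f * c"
  unfolding mean_def by (simp add: sum_distrib_right)

lemma mean_const: "finite A \<Longrightarrow> A \<noteq> {} \<Longrightarrow> mean A (\<lambda>x. c) = c"
  unfolding mean_def by simp

lemma mean_sum: "mean A (\<lambda>x. \<Sum>a\<in>K. f a x) = (\<Sum>a\<in>K. mean A (f a))"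
  unfolding mean_def by (subst sum.swap) (simp add: sum_divide_distrib)

lemma mean_swap: "mean A (\<lambda>x. mean B (f x)) = mean B (\<lambda>y. mean A (\<lambda>x. f x y))"
  unfolding mean_def by (simp add: sum_divide_distrib[symmetric], subst sum.swap) (simp add: ac_simps)

lemma mean_nonneg: "(\<And>x. x \<in> A \<Longrightarrow> 0 \<le> f x) \<Longrightarrow> 0 \<le> mean A f"
  unfolding mean_def by (intro divide_nonneg_nonneg sum_nonneg) auto

lemma mean_le_const:
  "finite A \<Longrightarrow> A \<noteq> {} \<Longrightarrow> (\<And>x. x \<in> A \<Longrightarrow> f x \<le> c) \<Longrightarrow> mean A f \<le> c"
  using mean_mono[of A f "\<lambda>_. c"] by (simp add: mean_const)

lemma abs_mean_le: "\<bar>mean A f\<bar> \<le> mean A (\<lambda>x. \<bar>f x\<bar>)"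
  unfolding mean_def by (simp add: divide_right_mono)

lemma mean_empty [simp]: "mean {} f = 0"
  unfolding mean_def by simp

text \<open>Jensen's inequality for \<open>x ^ n\<close> on the nonnegative reals: even powers are
  convex on the whole line, odd ones only there.\<close>

lemma mean_power_le:
  assumes "finite A" "A \<noteq> {}" "\<And>x. x \<in> A \<Longrightarrow> 0 \<le> f x"
  shows "mean A f ^ n \<le> mean A (\<lambda>x. f x ^ n)"
proof -
  have "mean A f ^ n = (\<Sum>x\<in>A. (1 / card A) *\<^sub>R f x) ^ n"
    by (simp add: mean_def sum_divide_distrib)
  also have "\<dots> \<le> (\<Sum>x\<in>A. (1 / card A) * f x ^ n)"
    using assms convex_on_subset[OF convex_power_even[of n]] convex_power_odd[of n]
    by (intro convex_on_sum[where f = "\<lambda>x. x ^ n" and C = "{0..}"])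
       (cases "even n"; auto simp: card_gt_0_iff)+
  finally show ?thesis by (simp add: mean_def sum_divide_distrib)
qed

lemma mean_abs_le_sqrt:
  assumes "finite A" "A \<noteq> {}" "mean A (\<lambda>x. (f x)\<^sup>2) \<le> B"
  shows "mean A (\<lambda>x. \<bar>f x\<bar>) \<le> sqrt B"
  using mean_power_le[of A "\<lambda>x. \<bar>f x\<bar>" 2] assms by (intro real_le_rsqrt) simp

section \<open>Uniform random functions and the independence of their coordinates\<close>

lemma sum_PiE_insert:
  assumes "i \<notin> J"
  shows "(\<Sum>f\<in>(insert i J \<rightarrow>\<^sub>E V). F f) = (\<Sum>x\<in>V. \<Sum>g\<in>(J \<rightarrow>\<^sub>E V). F (g(i := x)))"
proof -
  have "inj_on (\<lambda>(y, g). g(i := y)) (V \<times> (J \<rightarrow>\<^sub>E V))"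
    using inj_combinator[OF assms, of "\<lambda>_. V"] by simp
  then show ?thesis
    by (simp add: PiE_insert_eq sum.reindex sum.cartesian_product case_prod_unfold)
qed

text \<open>The coordinates are independent and uniform, so overwriting one of them by a fresh point
  of \<open>V\<close> leaves the distribution unchanged. In this form independence enters the
  variance, collision and triangle estimates.\<close>

lemma mean_PiE_resample:
  assumes "finite V" "V \<noteq> {}" "i \<in> I" "finite I"
  shows "mean (I \<rightarrow>\<^sub>E V) F = mean (I \<rightarrow>\<^sub>E V) (\<lambda>v. mean V (\<lambda>x. F (v(i := x))))"
proof -
  define J where "J = I - {i}"
  have I: "I = insert i J" "i \<notin> J" using assms by (auto simp: J_def)
  show ?thesis
    unfolding I(1) mean_def sum_PiE_insert[OF I(2)]
    using assms(1,2) by (simp add: sum_divide_distrib[symmetric], subst (2) sum.swap) (simp add: card_gt_0_iff)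
qed

lemma mean_PiE_point:
  assumes "finite V" "V \<noteq> {}" "i \<in> I" "finite I"
  shows "mean (I \<rightarrow>\<^sub>E V) (\<lambda>v. F (v i)) = mean V F"
  using assms by (subst mean_PiE_resample[OF assms]) (simp add: mean_const finite_PiE PiE_eq_empty_iff)

lemma mean_PiE_prod:
  assumes "finite I" "finite V"
  shows "mean (I \<rightarrow>\<^sub>E V) (\<lambda>v. \<Prod>i\<in>I. f (v i)) = mean V f ^ card I"
  using prod_sum_PiE[of I "\<lambda>_. V" "\<lambda>_. f"] assms
  by (simp add: mean_def card_PiE power_divide)

section \<open>Fractional and integral colourings\<close>

text \<open>\<open>E\<close> is a relation rather than a graph so that a sample \<open>v\<close> can
  be handled as the pulled-back relation \<open>\<lambda>i j. E (v i) (v j)\<close> on its index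
  set. For a graph on n vertices the value is 2 / n^2 times the number of monochromatic
  edges.\<close>

definition mono_density :: "'a set \<Rightarrow> ('a \<Rightarrow> 'a \<Rightarrow> bool) \<Rightarrow> ('a \<Rightarrow> nat) \<Rightarrow> real" where
  "mono_density V E c = mean V (\<lambda>u. mean V (\<lambda>w. of_bool (E u w \<and> c u = c w)))"

definition min_mono_density :: "'a set \<Rightarrow> ('a \<Rightarrow> 'a \<Rightarrow> bool) \<Rightarrow> nat \<Rightarrow> real" where
  "min_mono_density V E k = Min (mono_density V E ` (V \<rightarrow>\<^sub>E {..<k}))"

text \<open>For irreflexive \<open>E\<close>, the expected \<open>mono_density\<close> when every
  vertex \<open>u\<close> independently takes colour \<open>a\<close> with probability
  \<open>p u a\<close>.\<close>

definition frac_cost :: "'a set \<Rightarrow> ('a \<Rightarrow> 'a \<Rightarrow> bool) \<Rightarrow> nat \<Rightarrow> ('a \<Rightarrow> nat \<Rightarrow> real) \<Rightarrow> real" where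
  "frac_cost V E k p = mean V (\<lambda>u. mean V (\<lambda>w. of_bool (E u w) * (\<Sum>a<k. p u a * p w a)))"

definition frac_colouring :: "'a set \<Rightarrow> nat \<Rightarrow> ('a \<Rightarrow> nat \<Rightarrow> real) \<Rightarrow> bool" where
  "frac_colouring V k p \<longleftrightarrow> (\<forall>u\<in>V. (\<forall>a<k. 0 \<le> p u a) \<and> (\<Sum>a<k. p u a) = 1)"

lemma min_mono_density_le:
  assumes "finite V" "\<And>u. u \<in> V \<Longrightarrow> c u < k"
  shows "min_mono_density V E k \<le> mono_density V E c"
proof -
  have "mono_density V E c = mono_density V E (restrict c V)"
    unfolding mono_density_def by (intro mean_cong) simp
  then show ?thesis
    unfolding min_mono_density_def using assms by (auto intro!: Min_le finite_imageI finite_PiE)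
qed

lemma min_mono_density_attained:
  assumes "finite V" "k \<ge> 1"
  obtains c where "\<And>u. u \<in> V \<Longrightarrow> c u < k" "mono_density V E c = min_mono_density V E k"
proof -
  have "min_mono_density V E k \<in> mono_density V E ` (V \<rightarrow>\<^sub>E {..<k})"
    unfolding min_mono_density_def using assms
    by (intro Min_in) (auto simp: finite_PiE PiE_eq_empty_iff lessThan_empty_iff)
  then obtain c where "c \<in> V \<rightarrow>\<^sub>E {..<k}" "mono_density V E c = min_mono_density V E k" by auto
  then show ?thesis by (intro that[of c]) (auto simp: PiE_iff)
qed

lemma sum_delta_mult:
  fixes f :: "'a \<Rightarrow> real"
  assumes "finite A" "i \<in> A"
  shows "(\<Sum>a\<in>A. of_bool (a = i) * f a) = f i"
proof -
  have "(\<Sum>a\<in>A. of_bool (a = i) * f a) = (\<Sum>a\<in>A. if a = i then f a else 0)"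
    by (intro sum.cong) auto
  then show ?thesis using assms by simp
qed

text \<open>Irreflexivity removes the term quadratic in \<open>p v\<close>, so with the other
  vertices fixed the cost is affine in the law of \<open>v\<close>. An affine function on a simplex
  is minimal at a corner, that is, at a pure colour.\<close>

lemma round_vertex:
  assumes "finite V" "v \<in> V" "frac_colouring V k p" and irr: "\<And>u. \<not> E u u"
  shows "\<exists>a<k. frac_cost V E k (p(v := (\<lambda>b. of_bool (b = a)))) \<le> frac_cost V E k p"
proof -
  define U where "U = V - {v}"
  have V: "V = insert v U" "v \<notin> U" "finite U" using assms by (auto simp: U_def)
  \<comment> \<open>\<open>A\<close> is the part of the cost without \<open>v\<close>;
    \<open>B a\<close> is the cost of giving \<open>v\<close> the colour \<open>a\<close>, with
    pairs counted in both orders.\<close>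
  define A where "A = (\<Sum>u\<in>U. \<Sum>w\<in>U. of_bool (E u w) * (\<Sum>a<k. p u a * p w a))"
  define B where "B = (\<lambda>a. (\<Sum>u\<in>U. (of_bool (E u v) + of_bool (E v u)) * p u a))"
  have lin: "frac_cost V E k (p(v := q)) = (A + (\<Sum>a<k. q a * B a)) / (real (card V))\<^sup>2" for q
  proof -
    have "frac_cost V E k (p(v := q)) = (\<Sum>u\<in>V. \<Sum>w\<in>V. of_bool (E u w) *
        (\<Sum>a<k. (p(v := q)) u a * (p(v := q)) w a)) / (real (card V))\<^sup>2"
      by (simp add: frac_cost_def mean_def sum_divide_distrib[symmetric] power2_eq_square)
    also have "(\<Sum>u\<in>V. \<Sum>w\<in>V. of_bool (E u w) * (\<Sum>a<k. (p(v := q)) u a * (p(v := q)) w a)) =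
       (\<Sum>w\<in>U. of_bool (E v w) * (\<Sum>a<k. q a * p w a)) +
       (\<Sum>u\<in>U. of_bool (E u v) * (\<Sum>a<k. p u a * q a)) + A"
    proof -
      have *: "(p(v := q)) u = p u" if "u \<in> U" for u using that V(2) by auto
      have split: "(\<Sum>u\<in>V. \<Sum>w\<in>V. g u w) = g v v + (\<Sum>w\<in>U. g v w) + (\<Sum>u\<in>U. g u v) + (\<Sum>u\<in>U. \<Sum>w\<in>U. g u w)"
        for g :: "'a \<Rightarrow> 'a \<Rightarrow> real"
        using V by (simp add: sum.distrib)
      have "(\<Sum>w\<in>U. of_bool (E v w) * (\<Sum>a<k. (p(v := q)) v a * (p(v := q)) w a)) =
          (\<Sum>w\<in>U. of_bool (E v w) * (\<Sum>a<k. q a * p w a))"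
        by (intro sum.cong refl) (simp only: * fun_upd_same)
      moreover have "(\<Sum>u\<in>U. of_bool (E u v) * (\<Sum>a<k. (p(v := q)) u a * (p(v := q)) v a)) =
          (\<Sum>u\<in>U. of_bool (E u v) * (\<Sum>a<k. p u a * q a))"
        by (intro sum.cong refl) (simp only: * fun_upd_same)
      moreover have "(\<Sum>u\<in>U. \<Sum>w\<in>U. of_bool (E u w) * (\<Sum>a<k. (p(v := q)) u a * (p(v := q)) w a)) = A"
        unfolding A_def by (intro sum.cong refl) (simp only: *)
      ultimately show ?thesis
        unfolding split using irr[of v] by simp
    qed
    also have "(\<Sum>w\<in>U. of_bool (E v w) * (\<Sum>a<k. q a * p w a)) +
       (\<Sum>u\<in>U. of_bool (E u v) * (\<Sum>a<k. p u a * q a)) = (\<Sum>a<k. q a * B a)"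
      unfolding B_def sum_distrib_left sum.swap[of _ "{..<k}" U] sum.distrib[symmetric]
      by (intro sum.cong refl) (simp add: algebra_simps)
    finally show ?thesis by (simp add: add.commute del: fun_upd_apply)
  qed
  have p: "\<And>a. a < k \<Longrightarrow> 0 \<le> p v a" "(\<Sum>a<k. p v a) = 1"
    using assms by (auto simp: frac_colouring_def)
  then have "k \<noteq> 0" by (intro notI) simp
  then have "Min (B ` {..<k}) \<in> B ` {..<k}" by (intro Min_in) (auto simp: lessThan_empty_iff)
  then obtain a where a: "a < k" "B a = Min (B ` {..<k})" by auto
  then have a_min: "\<And>b. b < k \<Longrightarrow> B a \<le> B b" by simp
  have "(\<Sum>b<k. of_bool (b = a) * B b) = B a"
    using a(1) by (intro sum_delta_mult) auto
  also have "\<dots> = (\<Sum>b<k. p v b * B a)" using p(2) by (simp add: sum_distrib_right[symmetric])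
  also have "\<dots> \<le> (\<Sum>b<k. p v b * B b)"
    by (intro sum_mono mult_left_mono) (use a_min p in auto)
  finally have "frac_cost V E k (p(v := (\<lambda>b. of_bool (b = a)))) \<le> frac_cost V E k (p(v := p v))"
    unfolding lin by (intro divide_right_mono) auto
  with a(1) show ?thesis by auto
qed

text \<open>Method of conditional expectations: \<open>S\<close> is the set of vertices that already
  have a pure colour, and for \<open>S = V\<close> the fractional cost is a
  \<open>mono_density\<close>.\<close>

lemma rounding:
  assumes "finite V" "frac_colouring V k p" and irr: "\<And>u. \<not> E u u"
  shows "min_mono_density V E k \<le> frac_cost V E k p"
proof -
  have "\<exists>q c. frac_colouring V k q \<and> frac_cost V E k q \<le> frac_cost V E k p \<and>
          (\<forall>u\<in>S. c u < k \<and> q u = (\<lambda>b. of_bool (b = c u)))"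
    if "finite S" "S \<subseteq> V" for S
    using that
  proof (induction S)
    case empty
    then show ?case using assms(2) by auto
  next
    case (insert v S)
    then obtain q c where q: "frac_colouring V k q" "frac_cost V E k q \<le> frac_cost V E k p"
      "\<forall>u\<in>S. c u < k \<and> q u = (\<lambda>b. of_bool (b = c u))" by auto
    obtain a where a: "a < k" "frac_cost V E k (q(v := (\<lambda>b. of_bool (b = a)))) \<le> frac_cost V E k q"
      using round_vertex[of V v k q E] assms(1) irr q(1) insert.prems by auto
    have "frac_colouring V k (q(v := (\<lambda>b. of_bool (b = a))))"
      using q(1) a(1) sum_delta_mult[of "{..<k}" a "\<lambda>_. 1"] by (simp add: frac_colouring_def)
    moreover have "\<forall>u\<in>insert v S. (c(v := a)) u < k \<and>
        (q(v := (\<lambda>b. of_bool (b = a)))) u = (\<lambda>b. of_bool (b = (c(v := a)) u))"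
      using q(3) a(1) insert.hyps by auto
    moreover have "frac_cost V E k (q(v := (\<lambda>b. of_bool (b = a)))) \<le> frac_cost V E k p" using a(2) q(2) by linarith
    ultimately show ?case by blast
  qed
  from this[OF assms(1)] obtain q c where q: "frac_cost V E k q \<le> frac_cost V E k p"
    "\<forall>u\<in>V. c u < k \<and> q u = (\<lambda>b. of_bool (b = c u))" by auto
  have "(\<Sum>a<k. of_bool (a = i) * of_bool (a = j)) = (of_bool (i = j) :: real)" if "i < k" for i j
    using that by (subst sum_delta_mult) auto
  then have "frac_cost V E k q = mono_density V E c"
    unfolding frac_cost_def mono_density_def using q(2) by (intro mean_cong) (simp add: of_bool_conj)
  moreover have "min_mono_density V E k \<le> mono_density V E c" using q(2) assms(1) by (intro min_mono_density_le) auto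
  ultimately show ?thesis using q(1) by simp
qed

lemma mono_density_bounds: "0 \<le> mono_density V E c" "finite V \<Longrightarrow> V \<noteq> {} \<Longrightarrow> mono_density V E c \<le> 1"
  unfolding mono_density_def by (auto intro!: mean_nonneg mean_le_const)

lemma min_mono_density_bounds:
  assumes "finite V" "k \<ge> 1"
  shows "0 \<le> min_mono_density V E k" "V \<noteq> {} \<Longrightarrow> min_mono_density V E k \<le> 1"
proof -
  obtain c where c: "mono_density V E c = min_mono_density V E k" using min_mono_density_attained[OF assms] by blast
  show "0 \<le> min_mono_density V E k" "V \<noteq> {} \<Longrightarrow> min_mono_density V E k \<le> 1"
    unfolding c[symmetric] using mono_density_bounds[of V E c] assms(1) by auto
qed

section \<open>Graphs and relations\<close>

definition adj :: "'a ugraph \<Rightarrow> 'a \<Rightarrow> 'a \<Rightarrow> bool" where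
  "adj G u w \<longleftrightarrow> {u, w} \<in> edge_set G"

lemma adj_sym: "adj G u w = adj G w u"
  unfolding adj_def by (simp add: insert_commute)

lemma adj_irrefl: "simple_graph G \<Longrightarrow> \<not> adj G u u"
  unfolding adj_def simple_graph_def by fastforce

lemma adj_in: "simple_graph G \<Longrightarrow> adj G u w \<Longrightarrow> u \<in> vertex_set G \<and> w \<in> vertex_set G \<and> u \<noteq> w"
  using adj_irrefl[of G u] unfolding adj_def simple_graph_def by fastforce

lemma mono_density_card:
  assumes "finite V"
  shows "mono_density V E c * (real (card V))\<^sup>2 = real (card {(u, w) \<in> V \<times> V. E u w \<and> c u = c w})"
proof (cases "V = {}")
  case False
  have "(\<Sum>u\<in>V. \<Sum>w\<in>V. of_bool (E u w \<and> c u = c w)) =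
      (\<Sum>x\<in>V \<times> V. of_bool (E (fst x) (snd x) \<and> c (fst x) = c (snd x)) :: real)"
    by (simp add: sum.cartesian_product case_prod_unfold)
  also have "\<dots> = real (card {(u, w) \<in> V \<times> V. E u w \<and> c u = c w})"
    using assms by (subst sum_of_bool_eq) (auto intro!: arg_cong[where f = card])
  finally show ?thesis
    using False assms by (simp add: mono_density_def mean_def sum_divide_distrib[symmetric] power2_eq_square)
qed simp

lemma card_mono_edges:
  assumes G: "simple_graph G"
  shows "card {(u, w) \<in> vertex_set G \<times> vertex_set G. adj G u w \<and> c u = c w} =
    2 * card {e \<in> edge_set G. \<exists>u w. e = {u, w} \<and> c u = c w}"
proof -
  define D where "D = {e \<in> edge_set G. \<exists>u w. e = {u, w} \<and> c u = c w}"
  have fin: "finite D" using finite_edge_set[OF G] by (simp add: D_def)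
  have D2: "e \<subseteq> vertex_set G" "card e = 2" "e \<in> edge_set G" if "e \<in> D" for e
    using that G by (auto simp: D_def simple_graph_def)
  have mono: "c u = c w" if "{u, w} \<in> D" for u w
    using that by (auto simp: D_def doubleton_eq_iff)
  have "{(u, w) \<in> vertex_set G \<times> vertex_set G. adj G u w \<and> c u = c w} =
     (\<Union>e\<in>D. {(u, w). e = {u, w}})" (is "?L = ?R")
  proof (rule Set.set_eqI, rule iffI)
    fix x assume "x \<in> ?L"
    then show "x \<in> ?R" by (auto simp: D_def adj_def)
  next
    fix x assume "x \<in> ?R"
    then obtain u w where x: "x = (u, w)" "{u, w} \<in> D" by auto
    with D2[OF x(2)] mono[OF x(2)] show "x \<in> ?L" by (auto simp: adj_def)
  qed
  also have "card (\<Union>e\<in>D. {(u, w). e = {u, w}}) = (\<Sum>e\<in>D. card {(u, w). e = {u, w}})"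
  proof (rule card_UN_disjoint[OF fin])
    show "\<forall>e\<in>D. finite {(u, w). e = {u, w}}"
    proof
      fix e assume e: "e \<in> D"
      then have "finite e" using D2(2)[OF e] by (metis card.infinite zero_neq_numeral)
      moreover have "{(u, w). e = {u, w}} \<subseteq> e \<times> e" by auto
      ultimately show "finite {(u, w). e = {u, w}}" using finite_subset by blast
    qed
  qed auto
  also have "\<dots> = (\<Sum>e\<in>D. 2)"
  proof (rule sum.cong[OF refl])
    fix e assume "e \<in> D"
    then obtain u w where e: "e = {u, w}" "u \<noteq> w" using D2(2) by (meson card_2_iff)
    then have "{(u, w). e = {u, w}} = {(u, w), (w, u)}" by (auto simp: doubleton_eq_iff)
    with e show "card {(u, w). e = {u, w}} = 2" by simp
  qed
  finally show ?thesis by (simp add: D_def)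
qed

text \<open>A set of edges is a valid deletion set exactly if it contains all monochromatic edges of
  some \<open>k\<close>-colouring, so the minimum over deletion sets is a minimum over colourings.
  The factor 2 comes from ordered pairs.\<close>

lemma h_graph_eq:
  assumes G: "simple_graph G" and k: "k \<ge> 1"
  shows "2 * real (h_graph G k) = min_mono_density (vertex_set G) (adj G) k * (real (card (vertex_set G)))\<^sup>2"
proof -
  define V where "V = vertex_set G"
  define S where "S = {card D | D. D \<subseteq> edge_set G \<and> colorable k (delete_edges G D)}"
  have S: "finite S" "S \<noteq> {}" using h_graph_wf[OF G k] by (auto simp: S_def)
  have h: "h_graph G k = Min S" by (simp add: h_graph_def S_def)
  have finV: "finite V" using G by (simp add: V_def simple_graph_def)
  have md2: "mono_density V (adj G) c * (real (card V))\<^sup>2 =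
      2 * real (card {e \<in> edge_set G. \<exists>u w. e = {u, w} \<and> c u = c w})" for c :: "'a \<Rightarrow> nat"
    unfolding mono_density_card[OF finV] using card_mono_edges[OF G, of c] by (simp add: V_def)
  have "2 * real (Min S) \<le> min_mono_density V (adj G) k * (real (card V))\<^sup>2"
  proof -
    obtain c where c: "\<And>u. u \<in> V \<Longrightarrow> c u < k" "mono_density V (adj G) c = min_mono_density V (adj G) k"
      using min_mono_density_attained[OF finV k] by blast
    define D where "D = {e \<in> edge_set G. \<exists>u w. e = {u, w} \<and> c u = c w}"
    have "colorable k (delete_edges G D)"
      unfolding colorable_def delete_edges_def using c(1)
      by (intro exI[of _ c]) (auto simp: D_def V_def)
    then have "card D \<in> S" by (auto simp: S_def D_def)
    then have "Min S \<le> card D" using S by simp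
    then show ?thesis using md2[of c] c(2) by (simp add: D_def)
  qed
  moreover have "min_mono_density V (adj G) k * (real (card V))\<^sup>2 \<le> 2 * real (Min S)"
  proof -
    obtain D where D: "Min S = card D" "D \<subseteq> edge_set G" "colorable k (delete_edges G D)"
      using Min_in[OF S] unfolding S_def by auto
    then obtain c where c: "\<forall>v\<in>V. c v < k" "\<forall>u w. {u, w} \<in> edge_set G - D \<longrightarrow> c u \<noteq> c w"
      unfolding colorable_def delete_edges_def V_def by auto
    have "{e \<in> edge_set G. \<exists>u w. e = {u, w} \<and> c u = c w} \<subseteq> D" using c(2) by auto
    then have "card {e \<in> edge_set G. \<exists>u w. e = {u, w} \<and> c u = c w} \<le> card D"
      using D(2) finite_edge_set[OF G] by (meson card_mono finite_subset)
    moreover have "min_mono_density V (adj G) k \<le> mono_density V (adj G) c" using c(1) finV by (intro min_mono_density_le) auto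
    then have "min_mono_density V (adj G) k * (real (card V))\<^sup>2 \<le> mono_density V (adj G) c * (real (card V))\<^sup>2"
      by (rule mult_right_mono) simp
    ultimately show ?thesis using D(1) md2[of c] by simp
  qed
  ultimately show ?thesis unfolding h V_def by simp
qed

lemma h_max_ge:
  assumes "k \<ge> 1" "edge_set H \<noteq> {}" "simple_graph G" "card (vertex_set G) = n" "H_free H G"
  shows "h_graph (G :: nat ugraph) k \<le> h_max n k H"
  unfolding h_max_def using assms h_max_wf[OF assms(1,2), of n] by (intro Max_ge) auto

lemma h_max_attained:
  assumes "k \<ge> 1" "edge_set H \<noteq> {}"
  obtains G :: "nat ugraph" where "simple_graph G" "card (vertex_set G) = n" "H_free H G"
    "h_graph G k = h_max n k H"
proof -
  have "h_max n k H \<in> {h_graph G k | G :: nat ugraph.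
                  simple_graph G \<and> card (vertex_set G) = n \<and> H_free H G}"
    unfolding h_max_def using h_max_wf[OF assms, of n] by (intro Max_in) auto
  then show ?thesis using that by auto
qed

section \<open>Triangle-freeness as a property of relations\<close>

definition tri_free :: "('a \<Rightarrow> 'a \<Rightarrow> bool) \<Rightarrow> bool" where
  "tri_free E \<longleftrightarrow> (\<forall>x y z. \<not> (E x y \<and> E y z \<and> E x z))"

lemma complete_graph_3: "vertex_set (complete_graph 3) = {0, 1, 2}"
  "edge_set (complete_graph 3) = {{0, 1}, {1, 2}, {0, 2}}"
proof -
  show "vertex_set (complete_graph 3) = {0, 1, 2}"
    by (auto simp: complete_graph_def)
  have "e \<in> {{0, 1}, {1, 2}, {0, 2}}" if e: "e \<subseteq> {..<3::nat}" "card e = 2" for e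
  proof -
    obtain x y where xy: "e = {x, y}" "x \<noteq> y" using e(2) by (meson card_2_iff)
    then have "x \<in> {0, 1, 2}" "y \<in> {0, 1, 2}" using e(1) by auto
    then show ?thesis using xy by (auto simp: insert_commute)
  qed
  then show "edge_set (complete_graph 3) = {{0, 1}, {1, 2}, {0, 2}}"
    by (auto simp: complete_graph_def card_insert_if)
qed

lemma K3_free_iff:
  assumes G: "simple_graph G"
  shows "H_free (complete_graph 3) G \<longleftrightarrow> tri_free (adj G)"
proof
  assume F: "H_free (complete_graph 3) G"
  show "tri_free (adj G)"
    unfolding tri_free_def
  proof (intro allI notI)
    fix x y z assume a: "adj G x y \<and> adj G y z \<and> adj G x z"
    then have "x \<noteq> y" "y \<noteq> z" "x \<noteq> z" "x \<in> vertex_set G" "y \<in> vertex_set G" "z \<in> vertex_set G"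
      using adj_in[OF G] by blast+
    with a have "contains_graph G (complete_graph 3)"
      unfolding contains_graph_def complete_graph_3
      by (intro exI[of _ "(\<lambda>_. z)(0 := x, 1 := y)"]) (auto simp: adj_def inj_on_def insert_commute)
    with F show False by (simp add: H_free_def)
  qed
next
  assume T: "tri_free (adj G)"
  show "H_free (complete_graph 3) G"
    unfolding H_free_def
  proof
    assume "contains_graph G (complete_graph 3)"
    then obtain f where "\<forall>e\<in>edge_set (complete_graph 3). f ` e \<in> edge_set G"
      unfolding contains_graph_def by blast
    then have "adj G (f 0) (f 1) \<and> adj G (f 1) (f 2) \<and> adj G (f 0) (f 2)"
      unfolding complete_graph_3 adj_def by simp
    with T show False unfolding tri_free_def by blast
  qed
qed

section \<open>Blow-ups\<close>

text \<open>A colouring of \<open>W\<close> induces a fractional colouring of \<open>V\<close>: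
  \<open>p u a\<close> is the share of colour \<open>a\<close> among the \<open>b\<close> chosen
  copies of \<open>u\<close>. Its cost is the density of monochromatic pairs among the chosen
  copies, and rounding bounds it from below. Points of \<open>W\<close> outside the sets
  \<open>F u\<close> can only add monochromatic pairs.\<close>

lemma min_mono_density_blowup:
  fixes \<phi> :: "'b \<Rightarrow> 'a"
  assumes fin: "finite V" "V \<noteq> {}" "finite W" and irr: "\<And>u. \<not> E u u" and k: "k \<ge> 1"
    and F: "\<And>u. u \<in> V \<Longrightarrow> F u \<subseteq> W \<and> card (F u) = b \<and> (\<forall>x\<in>F u. \<phi> x = u)" and b: "b > 0"
  shows "(real b * real (card V))\<^sup>2 * min_mono_density V E k \<le> min_mono_density W (\<lambda>x y. E (\<phi> x) (\<phi> y)) k * (real (card W))\<^sup>2"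
proof -
  let ?E = "\<lambda>x y. E (\<phi> x) (\<phi> y)"
  obtain c where c: "\<And>u. u \<in> W \<Longrightarrow> c u < k" "mono_density W ?E c = min_mono_density W ?E k"
    using min_mono_density_attained[OF fin(3) k] by blast
  have finF: "finite (F u)" if "u \<in> V" for u using F[OF that] b by (metis card_gt_0_iff)
  define p where "p = (\<lambda>u a. mean (F u) (\<lambda>x. of_bool (c x = a)))"
  have eq: "(\<Sum>a<k. of_bool (c x = a) * of_bool (c y = a)) = (of_bool (c x = c y) :: real)"
    if "x \<in> W" for x y
    using c(1)[OF that] sum_delta_mult[of "{..<k}" "c x" "\<lambda>a. of_bool (c y = a)"]
    by (simp only: eq_commute[of "c x"] finite_lessThan lessThan_iff simp_thms)
  have "frac_colouring V k p"
    unfolding frac_colouring_def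
  proof (intro ballI conjI allI impI)
    fix u assume u: "u \<in> V"
    show "0 \<le> p u a" for a unfolding p_def by (rule mean_nonneg) simp
    have "(\<Sum>a<k. p u a) = mean (F u) (\<lambda>x. \<Sum>a<k. of_bool (c x = a))"
      unfolding p_def by (simp only: mean_sum)
    also have "\<dots> = mean (F u) (\<lambda>x. 1)"
    proof (rule mean_cong)
      fix x assume "x \<in> F u"
      then have "c x < k" using F[OF u] c(1) by auto
      then show "(\<Sum>a<k. of_bool (c x = a)) = (1::real)"
        using sum_delta_mult[of "{..<k}" "c x" "\<lambda>_. 1"] by (simp only: eq_commute[of "c x"] mult_1_right finite_lessThan lessThan_iff simp_thms)
    qed
    also have "\<dots> = 1" using finF[OF u] F[OF u] b by (intro mean_const) auto
    finally show "(\<Sum>a<k. p u a) = 1" .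
  qed
  then have "min_mono_density V E k \<le> frac_cost V E k p" using fin irr by (intro rounding)
  also have "frac_cost V E k p = mean V (\<lambda>u. mean V (\<lambda>w. mean (F u) (\<lambda>x. mean (F w) (\<lambda>y.
     of_bool (?E x y \<and> c x = c y)))))"
    unfolding frac_cost_def
  proof (intro mean_cong)
    fix u w assume u: "u \<in> V" and w: "w \<in> V"
    have "of_bool (E u w) * (\<Sum>a<k. p u a * p w a) =
      mean (F u) (\<lambda>x. mean (F w) (\<lambda>y. of_bool (E u w) * (\<Sum>a<k. of_bool (c x = a) * of_bool (c y = a))))"
      unfolding p_def by (simp only: mean_sum mean_cmult mean_multc)
    also have "\<dots> = mean (F u) (\<lambda>x. mean (F w) (\<lambda>y. of_bool (?E x y \<and> c x = c y)))"
    proof (intro mean_cong)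
      fix x y assume "x \<in> F u" "y \<in> F w"
      then have "x \<in> W" "\<phi> x = u" "\<phi> y = w" using F[OF u] F[OF w] by auto
      then show "of_bool (E u w) * (\<Sum>a<k. of_bool (c x = a) * of_bool (c y = a)) =
          (of_bool (?E x y \<and> c x = c y) :: real)"
        by (simp only: eq of_bool_conj)
    qed
    finally show "of_bool (E u w) * (\<Sum>a<k. p u a * p w a) =
      mean (F u) (\<lambda>x. mean (F w) (\<lambda>y. of_bool (?E x y \<and> c x = c y)))" .
  qed
  also have "\<dots> = (\<Sum>u\<in>V. \<Sum>w\<in>V. \<Sum>x\<in>F u. \<Sum>y\<in>F w. of_bool (?E x y \<and> c x = c y)) / (real b * real (card V))\<^sup>2"
    using F by (simp add: mean_def sum_divide_distrib[symmetric] power2_eq_square ac_simps cong: sum.cong)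
  finally have 1: "(real b * real (card V))\<^sup>2 * min_mono_density V E k \<le>
      (\<Sum>u\<in>V. \<Sum>w\<in>V. \<Sum>x\<in>F u. \<Sum>y\<in>F w. of_bool (?E x y \<and> c x = c y))"
    using b fin(1,2) by (simp add: pos_le_divide_eq card_gt_0_iff mult.commute)
  have disj: "\<forall>u\<in>V. \<forall>w\<in>V. u \<noteq> w \<longrightarrow> F u \<inter> F w = {}"
  proof (intro ballI impI equals0I)
    fix u w x assume "u \<in> V" "w \<in> V" "u \<noteq> w" "x \<in> F u \<inter> F w"
    then have "\<phi> x = u" "\<phi> x = w" using F[of u] F[of w] by auto
    with \<open>u \<noteq> w\<close> show False by simp
  qed
  have UN: "(\<Sum>u\<in>V. \<Sum>x\<in>F u. g x) = sum g (\<Union>(F ` V))" for g :: "'b \<Rightarrow> real"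
    using sum.UNION_disjoint[OF fin(1) _ disj, of g] finF by simp
  have sub: "\<Union>(F ` V) \<subseteq> W" using F by blast
  have "(\<Sum>u\<in>V. \<Sum>w\<in>V. \<Sum>x\<in>F u. \<Sum>y\<in>F w. of_bool (?E x y \<and> c x = c y)) =
     (\<Sum>x\<in>\<Union>(F ` V). \<Sum>y\<in>\<Union>(F ` V). of_bool (?E x y \<and> c x = c y) :: real)"
    unfolding UN[symmetric] by (intro sum.cong refl sum.swap)
  also have "\<dots> \<le> (\<Sum>x\<in>W. \<Sum>y\<in>W. of_bool (?E x y \<and> c x = c y))"
    by (rule order_trans[OF sum_mono[OF sum_mono2] sum_mono2]) (use sub fin(3) in \<open>auto intro: sum_nonneg\<close>)
  also have "\<dots> = mono_density W ?E c * (real (card W))\<^sup>2"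
    by (cases "W = {}") (use fin(3) in \<open>auto simp: mono_density_def mean_def sum_divide_distrib[symmetric] power2_eq_square\<close>)
  finally show ?thesis using 1 c(2) by simp
qed

text \<open>The number \<open>x\<close> becomes a copy of the vertex numbered
  \<open>x mod m\<close>. Only the \<open>n div m\<close> complete rounds count, so that all
  vertices have equally many copies; fewer than \<open>m\<close> points are left over, whence
  \<open>n - card V\<close>. The second disjunct excludes a negative difference, which squaring
  would hide.\<close>

lemma blowup_h_max:
  fixes E :: "'a \<Rightarrow> 'a \<Rightarrow> bool"
  assumes fin: "finite V" "V \<noteq> {}" and sym: "\<And>u w. E u w = E w u" and irr: "\<And>u. \<not> E u u"
    and tri: "\<And>x y z. x \<in> V \<Longrightarrow> y \<in> V \<Longrightarrow> z \<in> V \<Longrightarrow> \<not> (E x y \<and> E y z \<and> E x z)" and k: "k \<ge> 1"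
  shows "(real n - real (card V))\<^sup>2 * min_mono_density V E k \<le> 2 * real (h_max n k (complete_graph 3)) \<or> n < card V"
proof (cases "n < card V")
  case False
  define m where "m = card V"
  have m: "m > 0" "m \<le> n" using fin False by (auto simp: m_def card_gt_0_iff)
  obtain e where e: "bij_betw e {..<m} V"
    using ex_bij_betw_nat_finite[OF fin(1)] by (auto simp: m_def atLeast0LessThan)
  define \<phi> where "\<phi> = (\<lambda>x. e (x mod m))"
  have \<phi>V: "\<phi> x \<in> V" for x using e m(1) by (auto simp: \<phi>_def bij_betw_def)
  define b where "b = n div m"
  have b: "b > 0" using m by (simp add: b_def div_greater_zero_iff)
  define F where "F = (\<lambda>u. (\<lambda>i. i * m + inv_into {..<m} e u) ` {..<b})"
  define G where "G = \<lparr>vertex_set = {..<n}, edge_set = {{x, y} | x y. x < n \<and> y < n \<and> E (\<phi> x) (\<phi> y)}\<rparr>"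
  have G: "simple_graph G" using irr by (auto simp: simple_graph_def G_def card_insert_if)
  have adjG: "adj G x y \<longleftrightarrow> x < n \<and> y < n \<and> E (\<phi> x) (\<phi> y)" for x y
    using sym by (auto simp: adj_def G_def doubleton_eq_iff)
  have "H_free (complete_graph 3) G"
    unfolding K3_free_iff[OF G] tri_free_def adjG using tri \<phi>V by blast
  then have h: "h_graph G k \<le> h_max n k (complete_graph 3)"
    using k G by (intro h_max_ge) (auto simp: G_def complete_graph_3)
  have F: "F u \<subseteq> {..<n} \<and> card (F u) = b \<and> (\<forall>x\<in>F u. \<phi> x = u)" if u: "u \<in> V" for u
  proof -
    define i where "i = inv_into {..<m} e u"
    have "u \<in> e ` {..<m}" using u e by (auto simp: bij_betw_def)
    then have i: "i < m" "e i = u"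
      using inv_into_into[of u e "{..<m}"] f_inv_into_f[of u e "{..<m}"] by (auto simp: i_def)
    have "j * m + i < n" if "j < b" for j
    proof -
      have "j * m + i < (j + 1) * m" using i(1) by simp
      also have "\<dots> \<le> b * m" using that by (intro mult_right_mono) auto
      also have "\<dots> \<le> n" by (simp add: b_def)
      finally show ?thesis .
    qed
    moreover have "card (F u) = b"
      unfolding F_def using m(1) by (subst card_image) (auto simp: inj_on_def)
    moreover have "\<phi> (j * m + i) = u" for j using i by (simp add: \<phi>_def)
    ultimately show ?thesis unfolding F_def i_def[symmetric] by auto
  qed
  have "(real b * real m)\<^sup>2 * min_mono_density V E k \<le> min_mono_density {..<n} (\<lambda>x y. E (\<phi> x) (\<phi> y)) k * (real (card {..<n}))\<^sup>2"
    unfolding m_def by (rule min_mono_density_blowup[where F = F]) (use F b fin irr k in \<open>simp_all\<close>)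
  also have "min_mono_density {..<n} (\<lambda>x y. E (\<phi> x) (\<phi> y)) k = min_mono_density {..<n} (adj G) k"
    unfolding min_mono_density_def mono_density_def by (intro arg_cong[where f = Min] image_cong refl mean_cong) (simp add: adjG)
  also have "min_mono_density {..<n} (adj G) k * (real (card {..<n}))\<^sup>2 = 2 * real (h_graph G k)"
    using h_graph_eq[OF G k] by (simp add: G_def)
  also have "\<dots> \<le> 2 * real (h_max n k (complete_graph 3))" using h by simp
  finally have 1: "(real b * real m)\<^sup>2 * min_mono_density V E k \<le> 2 * real (h_max n k (complete_graph 3))" .
  have "n < b * m + m" unfolding b_def using m(1) by (metis div_mult_mod_eq add_less_cancel_left mod_less_divisor)
  then have "real n < real b * real m + real m" by (metis of_nat_add of_nat_less_iff of_nat_mult)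
  then have "(real n - real m)\<^sup>2 \<le> (real b * real m)\<^sup>2" using m by (intro power_mono) auto
  then have "(real n - real m)\<^sup>2 * min_mono_density V E k \<le> (real b * real m)\<^sup>2 * min_mono_density V E k"
    using min_mono_density_bounds(1)[OF fin(1) k] by (rule mult_right_mono)
  with 1 show ?thesis by (simp add: m_def)
qed simp

section \<open>Concentration of sample averages\<close>

text \<open>\<open>J\<close> holds the positions on which \<open>h\<close> may depend. Expand the
  square into products \<open>d v i * d v j\<close>: for \<open>i\<close> outside
  \<open>insert j J\<close>, resampling position \<open>i\<close> changes only the first factor and
  averages it to 0. For each \<open>j\<close> at most \<open>card J + 1\<close> values of
  \<open>i\<close> survive, with products at most 1.\<close>

lemma sample_second_moment:
  fixes h :: "('i \<Rightarrow> 'a) \<Rightarrow> 'a \<Rightarrow> real"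
  assumes V: "finite V" "V \<noteq> {}" and I: "finite I" "I \<noteq> {}" and J: "J \<subseteq> I"
    and dep: "\<And>v i x. i \<in> I - J \<Longrightarrow> h (v(i := x)) = h v"
    and bd: "\<And>v x. 0 \<le> h v x \<and> h v x \<le> 1"
  shows "mean (I \<rightarrow>\<^sub>E V) (\<lambda>v. (mean I (\<lambda>i. h v (v i)) - mean V (h v))\<^sup>2) \<le> (real (card J) + 1) / real (card I)"
proof -
  let ?X = "I \<rightarrow>\<^sub>E V"
  have X: "finite ?X" "?X \<noteq> {}" using V I by (auto simp: finite_PiE PiE_eq_empty_iff)
  define d where "d = (\<lambda>v i. h v (v i) - mean V (h v))"
  have mb: "0 \<le> mean V (h v) \<and> mean V (h v) \<le> 1" for v
    using bd V by (auto intro!: mean_nonneg mean_le_const)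
  have d1: "\<bar>d v i\<bar> \<le> 1" for v i
    using bd[of v "v i"] mb[of v] unfolding d_def by (auto simp: abs_if)
  have zero: "mean ?X (\<lambda>v. d v i * d v j) = 0" if "i \<in> I - J" "j \<noteq> i" "j \<in> I" for i j
  proof -
    have "mean ?X (\<lambda>v. d v i * d v j) = mean ?X (\<lambda>v. mean V (\<lambda>x. d (v(i := x)) i * d (v(i := x)) j))"
      using that V I by (intro mean_PiE_resample) auto
    also have "\<dots> = mean ?X (\<lambda>v. 0)"
    proof (rule mean_cong)
      fix v
      have "mean V (\<lambda>x. d (v(i := x)) i * d (v(i := x)) j) = mean V (\<lambda>x. h v x - mean V (h v)) * d v j"
        unfolding d_def mean_multc[symmetric] using that dep by simp
      also have "\<dots> = 0" using V by (simp add: mean_diff mean_const)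
      finally show "mean V (\<lambda>x. d (v(i := x)) i * d (v(i := x)) j) = 0" .
    qed
    finally show ?thesis using X by (simp add: mean_const)
  qed
  have "mean ?X (\<lambda>v. (mean I (\<lambda>i. h v (v i)) - mean V (h v))\<^sup>2) =
      mean ?X (\<lambda>v. mean I (\<lambda>i. mean I (\<lambda>j. d v i * d v j)))"
  proof (rule mean_cong)
    fix v
    have "mean I (\<lambda>i. h v (v i)) - mean V (h v) = mean I (d v)"
      unfolding d_def using I by (simp add: mean_diff mean_const)
    then show "(mean I (\<lambda>i. h v (v i)) - mean V (h v))\<^sup>2 = mean I (\<lambda>i. mean I (\<lambda>j. d v i * d v j))"
      by (simp add: power2_eq_square mean_cmult mean_multc)
  qed
  also have "\<dots> = mean I (\<lambda>j. mean ?X (\<lambda>v. mean I (\<lambda>i. d v j * d v i)))" by (rule mean_swap)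
  also have "\<dots> = mean I (\<lambda>j. mean I (\<lambda>i. mean ?X (\<lambda>v. d v i * d v j)))"
    by (intro mean_cong) (subst mean_swap, simp add: mult.commute)
  also have "\<dots> \<le> mean I (\<lambda>j. (real (card J) + 1) / real (card I))"
  proof (rule mean_mono)
    fix j assume j: "j \<in> I"
    have "mean I (\<lambda>i. mean ?X (\<lambda>v. d v i * d v j)) \<le> mean I (\<lambda>i. of_bool (i \<in> insert j J))"
    proof (rule mean_mono)
      fix i assume i: "i \<in> I"
      show "mean ?X (\<lambda>v. d v i * d v j) \<le> of_bool (i \<in> insert j J)"
      proof (cases "i \<in> insert j J")
        case True
        have "d v i * d v j \<le> 1" for v
          using mult_mono[OF d1[of v i] d1[of v j]] by (simp add: abs_mult[symmetric])
        then show ?thesis using True X by (auto intro!: mean_le_const)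
      next
        case False
        then have "mean ?X (\<lambda>v. d v i * d v j) = 0" using i j by (intro zero) auto
        then show ?thesis by simp
      qed
    qed
    also have "\<dots> \<le> real (card (insert j J)) / real (card I)"
    proof -
      have "I \<inter> insert j J \<subseteq> insert j J" "finite (insert j J)" using finite_subset[OF J I(1)] by auto
      then have "card (I \<inter> insert j J) \<le> card (insert j J)" by (rule card_mono[rotated])
      moreover have "(\<Sum>i\<in>I. of_bool (i \<in> insert j J)) = real (card (I \<inter> insert j J))"
        by (subst sum_of_bool_eq) (simp_all only: I(1) Collect_mem_eq)
      ultimately show ?thesis unfolding mean_def by (intro divide_right_mono) auto
    qed
    also have "\<dots> \<le> (real (card J) + 1) / real (card I)"
      using finite_subset[OF J I(1)] by (intro divide_right_mono) (auto simp: card_insert_if)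
    finally show "mean I (\<lambda>i. mean ?X (\<lambda>v. d v i * d v j)) \<le> (real (card J) + 1) / real (card I)" .
  qed
  also have "\<dots> = (real (card J) + 1) / real (card I)" using I by (simp add: mean_const)
  finally show ?thesis .
qed

lemma sample_deviation:
  fixes h :: "('i \<Rightarrow> 'a) \<Rightarrow> 'a \<Rightarrow> real"
  assumes V: "finite V" "V \<noteq> {}" and I: "finite I" "I \<noteq> {}" and J: "J \<subseteq> I"
    and "\<And>v i x. i \<in> I - J \<Longrightarrow> h (v(i := x)) = h v"
    and "\<And>v x. 0 \<le> h v x \<and> h v x \<le> 1" and s: "real (card J) \<le> s"
  shows "mean (I \<rightarrow>\<^sub>E V) (\<lambda>v. \<bar>mean I (\<lambda>i. h v (v i)) - mean V (h v)\<bar>) \<le> sqrt ((s + 1) / real (card I))"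
proof (rule mean_abs_le_sqrt)
  show "mean (I \<rightarrow>\<^sub>E V) (\<lambda>v. (mean I (\<lambda>i. h v (v i)) - mean V (h v))\<^sup>2) \<le> (s + 1) / real (card I)"
    using s by (intro order_trans[OF sample_second_moment[OF assms(1-7)]] divide_right_mono) auto
qed (use V I in \<open>auto simp: finite_PiE PiE_eq_empty_iff\<close>)

text \<open>Two applications of the one-variable estimate, first to the inner average (where the
  position i of the outer average is frozen as well) and then to the outer one.\<close>

lemma sample_deviation2:
  fixes g :: "('i \<Rightarrow> 'a) \<Rightarrow> 'a \<Rightarrow> 'a \<Rightarrow> real"
  assumes V: "finite V" "V \<noteq> {}" and I: "finite I" "I \<noteq> {}" and J: "J \<subseteq> I"
    and dep: "\<And>v i x. i \<in> I - J \<Longrightarrow> g (v(i := x)) = g v"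
    and bd: "\<And>v x y. 0 \<le> g v x y \<and> g v x y \<le> 1" and s: "real (card J) \<le> s"
  shows "mean (I \<rightarrow>\<^sub>E V) (\<lambda>v. \<bar>mean I (\<lambda>i. mean I (\<lambda>j. g v (v i) (v j))) -
            mean V (\<lambda>x. mean V (g v x))\<bar>) \<le> 2 * sqrt ((s + 2) / real (card I))"
proof -
  let ?X = "I \<rightarrow>\<^sub>E V"
  let ?B = "sqrt ((s + 2) / real (card I))"
  have "mean ?X (\<lambda>v. \<bar>mean I (\<lambda>i. mean I (\<lambda>j. g v (v i) (v j))) - mean V (\<lambda>x. mean V (g v x))\<bar>) \<le>
     mean ?X (\<lambda>v. mean I (\<lambda>i. \<bar>mean I (\<lambda>j. g v (v i) (v j)) - mean V (g v (v i))\<bar>) +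
       \<bar>mean I (\<lambda>i. mean V (g v (v i))) - mean V (\<lambda>x. mean V (g v x))\<bar>)"
  proof (rule mean_mono)
    fix v
    have "\<bar>mean I (\<lambda>i. mean I (\<lambda>j. g v (v i) (v j))) - mean I (\<lambda>i. mean V (g v (v i)))\<bar> \<le>
       mean I (\<lambda>i. \<bar>mean I (\<lambda>j. g v (v i) (v j)) - mean V (g v (v i))\<bar>)"
      unfolding mean_diff[symmetric] by (rule abs_mean_le)
    then show "\<bar>mean I (\<lambda>i. mean I (\<lambda>j. g v (v i) (v j))) - mean V (\<lambda>x. mean V (g v x))\<bar> \<le>
      mean I (\<lambda>i. \<bar>mean I (\<lambda>j. g v (v i) (v j)) - mean V (g v (v i))\<bar>) +
       \<bar>mean I (\<lambda>i. mean V (g v (v i))) - mean V (\<lambda>x. mean V (g v x))\<bar>" by linarith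
  qed
  also have "\<dots> = mean I (\<lambda>i. mean ?X (\<lambda>v. \<bar>mean I (\<lambda>j. g v (v i) (v j)) - mean V (g v (v i))\<bar>)) +
      mean ?X (\<lambda>v. \<bar>mean I (\<lambda>i. mean V (g v (v i))) - mean V (\<lambda>x. mean V (g v x))\<bar>)"
    by (simp add: mean_add mean_swap[of ?X])
  also have "\<dots> \<le> ?B + ?B"
  proof (rule add_mono)
    show "mean I (\<lambda>i. mean ?X (\<lambda>v. \<bar>mean I (\<lambda>j. g v (v i) (v j)) - mean V (g v (v i))\<bar>)) \<le> ?B"
    proof (rule mean_le_const[OF I])
      fix i assume i: "i \<in> I"
      have "mean ?X (\<lambda>v. \<bar>mean I (\<lambda>j. g v (v i) (v j)) - mean V (g v (v i))\<bar>)
          \<le> sqrt (((s + 1) + 1) / real (card I))"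
      proof (rule sample_deviation[where J = "insert i J" and h = "\<lambda>v. g v (v i)"])
        show "real (card (insert i J)) \<le> s + 1"
          using s finite_subset[OF J I(1)] by (auto simp: card_insert_if)
      qed (use V I J dep bd i in auto)
      then show "mean ?X (\<lambda>v. \<bar>mean I (\<lambda>j. g v (v i) (v j)) - mean V (g v (v i))\<bar>) \<le> ?B" by (simp add: add.commute)
    qed
    have "mean ?X (\<lambda>v. \<bar>mean I (\<lambda>i. mean V (g v (v i))) - mean V (\<lambda>x. mean V (g v x))\<bar>) \<le>
        sqrt ((s + 1) / real (card I))"
      by (rule sample_deviation[where J = J and h = "\<lambda>v x. mean V (g v x)"])
         (use V I J dep bd s in \<open>auto intro!: mean_nonneg mean_le_const\<close>)
    also have "\<dots> \<le> ?B" using s by (intro real_sqrt_le_mono divide_right_mono) auto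
    finally show "mean ?X (\<lambda>v. \<bar>mean I (\<lambda>i. mean V (g v (v i))) - mean V (\<lambda>x. mean V (g v x))\<bar>) \<le> ?B" .
  qed
  finally show ?thesis by simp
qed

section \<open>Energy increment along signatures\<close>

text \<open>Conditional expectation of \<open>f\<close> on the class \<open>\<phi> = s\<close> under
  the uniform measure on \<open>I\<close>; an empty class gets 0 through
  \<open>mean_empty\<close>.\<close>

definition cond :: "'i set \<Rightarrow> ('i \<Rightarrow> 's) \<Rightarrow> ('i \<Rightarrow> real) \<Rightarrow> 's \<Rightarrow> real" where
  "cond I \<phi> f s = mean {j \<in> I. \<phi> j = s} f"

text \<open>On each class \<open>\<gamma> \<circ> \<phi>\<close> is constant, so \<open>f\<close>
  may be replaced by its class averages: conditional expectation is the orthogonal projection onto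
  functions of \<open>\<phi>\<close>.\<close>

lemma cond_adjoint:
  assumes I: "finite I"
  shows "mean I (\<lambda>i. f i * \<gamma> (\<phi> i)) = mean I (\<lambda>i. cond I \<phi> f (\<phi> i) * \<gamma> (\<phi> i))"
proof -
  have fib: "(\<Sum>i\<in>{j \<in> I. \<phi> j = s}. f i * \<gamma> (\<phi> i)) = (\<Sum>i\<in>{j \<in> I. \<phi> j = s}. cond I \<phi> f (\<phi> i) * \<gamma> (\<phi> i))" for s
  proof (cases "{j \<in> I. \<phi> j = s} = {}")
    case False
    define B where "B = {j \<in> I. \<phi> j = s}"
    have B: "finite B" "B \<noteq> {}" using I False by (auto simp: B_def)
    have "(\<Sum>i\<in>B. f i * \<gamma> (\<phi> i)) = (\<Sum>i\<in>B. f i * \<gamma> s)"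
      by (intro sum.cong) (auto simp: B_def)
    also have "\<dots> = (\<Sum>i\<in>B. mean B f * \<gamma> s)"
      using B by (simp add: sum_distrib_right[symmetric] mean_def)
    also have "\<dots> = (\<Sum>i\<in>B. cond I \<phi> f (\<phi> i) * \<gamma> (\<phi> i))"
      by (intro sum.cong) (auto simp: B_def cond_def)
    finally show ?thesis by (simp add: B_def)
  qed (simp only: sum.empty)
  show ?thesis
    unfolding mean_def sum.image_gen[OF I, of _ \<phi>] by (simp only: fib)
qed

lemma cond_bounds:
  assumes "finite I" "\<And>i. i \<in> I \<Longrightarrow> 0 \<le> f i \<and> f i \<le> 1"
  shows "0 \<le> cond I \<phi> f s \<and> cond I \<phi> f s \<le> 1"
proof -
  have "mean {j \<in> I. \<phi> j = s} f \<le> 1"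
    using assms by (cases "{j \<in> I. \<phi> j = s} = {}") (simp_all only: mean_empty, auto intro!: mean_le_const)
  then show ?thesis
    unfolding cond_def using assms by (auto intro!: mean_nonneg)
qed

lemma mean_square_mult_le:
  assumes "finite I" "\<And>i. i \<in> I \<Longrightarrow> \<bar>A i\<bar> \<le> 1"
  shows "(mean I (\<lambda>i. x i * A i))\<^sup>2 \<le> mean I (\<lambda>i. (x i)\<^sup>2)"
proof (cases "I = {}")
  case False
  have "(mean I (\<lambda>i. x i * A i))\<^sup>2 = \<bar>mean I (\<lambda>i. x i * A i)\<bar>\<^sup>2" by simp
  also have "\<dots> \<le> (mean I (\<lambda>i. \<bar>x i * A i\<bar>))\<^sup>2" by (intro power_mono abs_mean_le) simp
  also have "\<dots> \<le> mean I (\<lambda>i. \<bar>x i * A i\<bar>\<^sup>2)" using assms(1) False by (intro mean_power_le) auto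
  also have "\<dots> \<le> mean I (\<lambda>i. (x i)\<^sup>2)"
  proof (rule mean_mono)
    fix i assume "i \<in> I"
    then have "\<bar>x i * A i\<bar> \<le> \<bar>x i\<bar> * 1" unfolding abs_mult by (intro mult_left_mono assms) auto
    then have "\<bar>x i * A i\<bar>\<^sup>2 \<le> \<bar>x i\<bar>\<^sup>2" by (intro power_mono) auto
    then show "\<bar>x i * A i\<bar>\<^sup>2 \<le> (x i)\<^sup>2" by simp
  qed
  finally show ?thesis .
qed simp

text \<open>By \<open>\<phi> = \<pi> \<circ> \<psi>\<close> the classes of \<open>\<psi>\<close>
  refine those of \<open>\<phi>\<close>. As \<open>A\<close> is a function of \<open>\<psi>\<close>,
  \<open>f\<close> may be replaced by its projection \<open>q\<close> in the correlation; Jensen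
  then bounds the square by the mean of \<open>(q - p)^2\<close>, which is the energy difference by
  Pythagoras.\<close>

lemma energy_increment:
  assumes I: "finite I" and \<pi>: "\<And>i. i \<in> I \<Longrightarrow> \<phi> i = \<pi> (\<psi> i)" and A: "\<And>i. i \<in> I \<Longrightarrow> A i = \<alpha> (\<psi> i)"
    and A1: "\<And>i. i \<in> I \<Longrightarrow> \<bar>A i\<bar> \<le> 1"
  shows "(mean I (\<lambda>i. (f i - cond I \<phi> f (\<phi> i)) * A i))\<^sup>2 \<le>
    mean I (\<lambda>i. (cond I \<psi> f (\<psi> i))\<^sup>2) - mean I (\<lambda>i. (cond I \<phi> f (\<phi> i))\<^sup>2)"
proof -
  define p where "p = (\<lambda>i. cond I \<phi> f (\<phi> i))"
  define q where "q = (\<lambda>i. cond I \<psi> f (\<psi> i))"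
  have fA: "mean I (\<lambda>i. f i * A i) = mean I (\<lambda>i. q i * A i)"
    using cond_adjoint[OF I, of f \<alpha> \<psi>] A by (simp add: q_def cong: mean_cong)
  have fp: "mean I (\<lambda>i. f i * p i) = mean I (\<lambda>i. p i * p i)"
    using cond_adjoint[OF I, of f "cond I \<phi> f" \<phi>] by (simp add: p_def)
  have fq: "mean I (\<lambda>i. f i * p i) = mean I (\<lambda>i. q i * p i)"
    using cond_adjoint[OF I, of f "\<lambda>s. cond I \<phi> f (\<pi> s)" \<psi>] \<pi> by (simp add: p_def q_def cong: mean_cong)
  have "mean I (\<lambda>i. (f i - p i) * A i) = mean I (\<lambda>i. (q i - p i) * A i)"
    using fA by (simp add: left_diff_distrib mean_diff)
  then have "(mean I (\<lambda>i. (f i - p i) * A i))\<^sup>2 \<le> mean I (\<lambda>i. (q i - p i)\<^sup>2)"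
    using mean_square_mult_le[OF I A1, where x = "\<lambda>i. q i - p i"] by simp
  also have "\<dots> = mean I (\<lambda>i. (q i)\<^sup>2) - mean I (\<lambda>i. (p i)\<^sup>2)"
    using fp fq by (simp add: power2_diff mean_add mean_diff mean_cmult mult.assoc)
       (simp add: power2_eq_square)
  finally show ?thesis by (simp add: p_def q_def)
qed

text \<open>A set rather than a bit string: passing to fewer reference vertices is then intersection
  with an initial segment.\<close>

definition signature :: "('a \<Rightarrow> 'a \<Rightarrow> bool) \<Rightarrow> (nat \<Rightarrow> 'a) \<Rightarrow> nat \<Rightarrow> 'a \<Rightarrow> nat set" where
  "signature E t s x = {r. r < s \<and> E x (t r)}"

text \<open>How badly the fractional colouring obtained by averaging the colour class a over
  signatures misses the neighbourhood of j.\<close>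

definition discrepancy :: "'i set \<Rightarrow> ('i \<Rightarrow> 'i \<Rightarrow> bool) \<Rightarrow> (nat \<Rightarrow> 'i) \<Rightarrow> nat \<Rightarrow> ('i \<Rightarrow> nat) \<Rightarrow> nat \<Rightarrow> 'i \<Rightarrow> real" where
  "discrepancy I A t s c a j = mean I (\<lambda>i. (of_bool (c i = a) -
      cond I (signature A t s) (\<lambda>i. of_bool (c i = a)) (signature A t s i)) * of_bool (A i j))"

text \<open>\<open>energy_increment\<close> with adjacency to \<open>t s\<close> as test function
  bounds each square by the energy gained when \<open>t s\<close> becomes a reference vertex, and
  the gains telescope. The final energy is at most 1 for any number of colours, because the averages
  lie in [0, 1] and the colour classes partition \<open>I\<close>.\<close>

lemma sum_discrepancy_le_one:
  assumes I: "finite I" "I \<noteq> {}" and c: "\<And>i. i \<in> I \<Longrightarrow> c i < k"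
  shows "(\<Sum>s<S. \<Sum>a<k. (discrepancy I A t s c a (t s))\<^sup>2) \<le> 1"
proof -
  let ?f = "\<lambda>a i. of_bool (c i = a) :: real"
  define p where "p = (\<lambda>s a i. cond I (signature A t s) (?f a) (signature A t s i))"
  define en where "en = (\<lambda>s. \<Sum>a<k. mean I (\<lambda>i. (p s a i)\<^sup>2))"
  have "(\<Sum>a<k. (discrepancy I A t s c a (t s))\<^sup>2) \<le> en (Suc s) - en s" for s
    unfolding en_def sum_subtractf[symmetric]
  proof (rule sum_mono)
    fix a
    show "(discrepancy I A t s c a (t s))\<^sup>2 \<le> mean I (\<lambda>i. (p (Suc s) a i)\<^sup>2) - mean I (\<lambda>i. (p s a i)\<^sup>2)"
      unfolding discrepancy_def p_def
    proof (rule energy_increment[OF I(1), where \<pi> = "\<lambda>R. R \<inter> {..<s}" and \<alpha> = "\<lambda>R. of_bool (s \<in> R)"])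
      show "signature A t s i = signature A t (Suc s) i \<inter> {..<s}" for i by (auto simp: signature_def)
      show "of_bool (A i (t s)) = (of_bool (s \<in> signature A t (Suc s) i) :: real)" for i by (simp add: signature_def)
    qed simp
  qed
  then have "(\<Sum>s<S. \<Sum>a<k. (discrepancy I A t s c a (t s))\<^sup>2) \<le> (\<Sum>s<S. en (Suc s) - en s)"
    by (rule sum_mono)
  also have "\<dots> = en S - en 0" by (rule sum_lessThan_telescope)
  also have "\<dots> \<le> en S" unfolding en_def by (simp add: sum_nonneg mean_nonneg)
  also have "en S \<le> (\<Sum>a<k. mean I (p S a))"
    unfolding en_def
  proof (intro sum_mono mean_mono)
    fix a i
    have "0 \<le> p S a i \<and> p S a i \<le> 1" unfolding p_def using I by (intro cond_bounds) auto
    then show "(p S a i)\<^sup>2 \<le> p S a i" by (simp add: power2_eq_square mult_left_le)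
  qed
  also have "\<dots> = (\<Sum>a<k. mean I (?f a))"
    using cond_adjoint[OF I(1), of "?f a" "\<lambda>_. 1" "signature A t S" for a] by (simp add: p_def)
  also have "\<dots> = mean I (\<lambda>i. \<Sum>a<k. ?f a i)" by (simp only: mean_sum)
  also have "\<dots> = mean I (\<lambda>i. 1)"
  proof (rule mean_cong)
    fix i assume "i \<in> I"
    then show "(\<Sum>a<k. ?f a i) = 1"
      using c[of i] sum_delta_mult[of "{..<k}" "c i" "\<lambda>_. 1"]
      by (simp only: eq_commute[of "c i"] mult_1_right finite_lessThan lessThan_iff simp_thms)
  qed
  also have "\<dots> = 1" using I by (rule mean_const)
  finally show ?thesis .
qed

text \<open>The discrepancy at stage \<open>s\<close> uses only \<open>t r\<close> for
  \<open>r < s\<close>, so \<open>t s\<close> is independent of it, and evaluating at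
  \<open>t s\<close> is on average the same as averaging over all \<open>j\<close>.\<close>

lemma mean_discrepancy_le_one:
  assumes I: "finite I" "I \<noteq> {}" and c: "\<And>i. i \<in> I \<Longrightarrow> c i < k"
  shows "(\<Sum>s<S. mean ({..<S} \<rightarrow>\<^sub>E I) (\<lambda>t. mean I (\<lambda>j. \<Sum>a<k. (discrepancy I A t s c a j)\<^sup>2))) \<le> 1"
proof -
  let ?T = "{..<S} \<rightarrow>\<^sub>E I"
  have T: "finite ?T" "?T \<noteq> {}" using I by (auto simp: finite_PiE PiE_eq_empty_iff)
  have "mean ?T (\<lambda>t. mean I (\<lambda>j. \<Sum>a<k. (discrepancy I A t s c a j)\<^sup>2)) =
      mean ?T (\<lambda>t. \<Sum>a<k. (discrepancy I A t s c a (t s))\<^sup>2)" if "s < S" for s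
  proof -
    have "signature A (t(s := j)) s = signature A t s" for t j by (auto simp: signature_def fun_eq_iff)
    then have "discrepancy I A (t(s := j)) s c a = discrepancy I A t s c a" for t j a
      unfolding discrepancy_def by simp
    then show ?thesis
      using that I by (subst (2) mean_PiE_resample[where i = s]) auto
  qed
  then have "(\<Sum>s<S. mean ?T (\<lambda>t. mean I (\<lambda>j. \<Sum>a<k. (discrepancy I A t s c a j)\<^sup>2))) =
      mean ?T (\<lambda>t. \<Sum>s<S. \<Sum>a<k. (discrepancy I A t s c a (t s))\<^sup>2)"
    by (simp add: mean_sum del: of_bool_eq)
  also have "\<dots> \<le> 1" by (intro mean_le_const[OF T] sum_discrepancy_le_one[OF I c])
  finally show ?thesis .
qed

text \<open>With \<open>x\<close> the indicator of a colour class and \<open>p\<close> its averages,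
  \<open>x i * x j - p i * p j = (x i - p i) * x j + (x j - p j) * p i\<close>. Summation against
  \<open>A\<close> turns each term into a discrepancy times a factor of modulus at most 1. The
  parameter \<open>\<eta>\<close> converts these linear terms into the squares that the energy
  controls.\<close>

lemma frac_cost_cond_le:
  assumes I: "finite I" "I \<noteq> {}" and c: "\<And>i. i \<in> I \<Longrightarrow> c i < k" and \<eta>: "\<eta> > 0"
    and sym: "\<And>i j. A i j = A j i"
  shows "frac_cost I A k (\<lambda>i a. cond I (signature A t s) (\<lambda>i. of_bool (c i = a)) (signature A t s i)) \<le>
    mono_density I A c + real k * \<eta> + mean I (\<lambda>j. \<Sum>a<k. (discrepancy I A t s c a j)\<^sup>2) / \<eta>"
proof -
  define x where "x = (\<lambda>a i. of_bool (c i = a) :: real)"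
  define p where "p = (\<lambda>a i. cond I (signature A t s) (x a) (signature A t s i))"
  define D where "D = (\<lambda>i j. of_bool (A i j) :: real)"
  define R where "R = (\<lambda>a j. mean I (\<lambda>i. (x a i - p a i) * D i j))"
  have R: "R a j = discrepancy I A t s c a j" for a j
    by (simp add: R_def discrepancy_def x_def p_def D_def)
  have x1: "\<bar>x a i\<bar> \<le> 1" for a i by (simp add: x_def)
  have p1: "\<bar>p a i\<bar> \<le> 1" for a i
  proof -
    have "0 \<le> p a i \<and> p a i \<le> 1"
      unfolding p_def using I by (intro cond_bounds) (auto simp: x_def)
    then show ?thesis by simp
  qed
  have mono_density: "mono_density I A c = (\<Sum>a<k. mean I (\<lambda>i. mean I (\<lambda>j. D i j * (x a i * x a j))))"
    unfolding mono_density_def mean_sum[symmetric]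
  proof (intro mean_cong)
    fix i j assume "i \<in> I" "j \<in> I"
    then have "c i < k" using c by auto
    have x': "x a i = of_bool (a = c i)" for a i by (auto simp: x_def)
    have "(\<Sum>a<k. x a i * x a j) = of_bool (c i = c j)"
      unfolding x' using \<open>c i < k\<close> by (intro sum_delta_mult) auto
    then show "of_bool (A i j \<and> c i = c j) = (\<Sum>a<k. D i j * (x a i * x a j))"
      by (simp only: D_def of_bool_conj sum_distrib_left[symmetric])
  qed
  have frac_cost: "frac_cost I A k (\<lambda>i a. p a i) = (\<Sum>a<k. mean I (\<lambda>i. mean I (\<lambda>j. D i j * (p a i * p a j))))"
    unfolding frac_cost_def mean_sum[symmetric] D_def by (simp only: sum_distrib_left)
  have one: "mean I (\<lambda>i. mean I (\<lambda>j. D i j * (p a i * p a j))) \<le>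
     mean I (\<lambda>i. mean I (\<lambda>j. D i j * (x a i * x a j))) + \<eta> + mean I (\<lambda>j. (R a j)\<^sup>2) / \<eta>" for a
  proof -
    have Dsym: "D j i = D i j" for i j using sym by (simp add: D_def)
    have e1: "mean I (\<lambda>i. mean I (\<lambda>j. (x a i - p a i) * D i j * x a j)) = mean I (\<lambda>j. R a j * x a j)"
      unfolding R_def mean_multc[symmetric] by (rule mean_swap)
    have e2: "mean I (\<lambda>i. mean I (\<lambda>j. (x a j - p a j) * D j i * p a i)) = mean I (\<lambda>j. R a j * p a j)"
      unfolding R_def mean_multc[symmetric] by simp
    have "mean I (\<lambda>i. mean I (\<lambda>j. D i j * (x a i * x a j))) - mean I (\<lambda>i. mean I (\<lambda>j. D i j * (p a i * p a j))) =
      mean I (\<lambda>i. mean I (\<lambda>j. (x a i - p a i) * D i j * x a j + (x a j - p a j) * D j i * p a i))"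
      unfolding mean_diff[symmetric]
    proof (intro mean_cong)
      fix i j
      show "D i j * (x a i * x a j) - D i j * (p a i * p a j) =
          (x a i - p a i) * D i j * x a j + (x a j - p a j) * D j i * p a i"
        unfolding Dsym[of j i] by (simp add: algebra_simps)
    qed
    also have "\<dots> = mean I (\<lambda>j. R a j * x a j + R a j * p a j)"
      by (simp only: mean_add e1 e2)
    also have "\<dots> \<ge> mean I (\<lambda>j. - (\<eta> + (R a j)\<^sup>2 / \<eta>))"
    proof (rule mean_mono)
      fix j
      \<comment> \<open>AM-GM: 2 |R| is at most eta + R^2 / eta\<close>
      have "0 \<le> (\<bar>R a j\<bar> - \<eta>)\<^sup>2 / \<eta>" using \<eta> by simp
      also have "\<dots> = (R a j)\<^sup>2 / \<eta> - 2 * \<bar>R a j\<bar> + \<eta>"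
        using \<eta> by (simp add: power2_diff field_simps power2_eq_square)
      finally have "2 * \<bar>R a j\<bar> \<le> \<eta> + (R a j)\<^sup>2 / \<eta>" by simp
      moreover have "\<bar>R a j * x a j\<bar> \<le> \<bar>R a j\<bar> * 1" "\<bar>R a j * p a j\<bar> \<le> \<bar>R a j\<bar> * 1"
        unfolding abs_mult by (intro mult_left_mono x1 p1; simp)+
      ultimately show "- (\<eta> + (R a j)\<^sup>2 / \<eta>) \<le> R a j * x a j + R a j * p a j" by linarith
    qed
    also have "mean I (\<lambda>j. - (\<eta> + (R a j)\<^sup>2 / \<eta>)) = - (\<eta> + mean I (\<lambda>j. (R a j)\<^sup>2) / \<eta>)"
      using mean_cmult[of I "-1" "\<lambda>j. \<eta> + (R a j)\<^sup>2 / \<eta>"] mean_multc[of I "\<lambda>j. (R a j)\<^sup>2" "1 / \<eta>"] I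
      by (simp add: mean_add mean_const)
    finally show ?thesis by simp
  qed
  have "frac_cost I A k (\<lambda>i a. p a i) \<le> (\<Sum>a<k. mean I (\<lambda>i. mean I (\<lambda>j. D i j * (x a i * x a j))) + \<eta> + mean I (\<lambda>j. (R a j)\<^sup>2) / \<eta>)"
    unfolding frac_cost by (intro sum_mono one)
  also have "\<dots> = mono_density I A c + real k * \<eta> + mean I (\<lambda>j. \<Sum>a<k. (R a j)\<^sup>2) / \<eta>"
    unfolding mono_density by (simp add: sum.distrib sum_divide_distrib mean_sum)
  finally show ?thesis unfolding R p_def x_def .
qed

section \<open>Optimal colourings of a sample extend to the whole graph\<close>

text \<open>Sorting pairs by signature separates the kernel \<open>K\<close>, which will carry the
  colouring, from densities that do not see it.\<close>

lemma mean_mean_signature: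
  fixes F :: "'a \<Rightarrow> 'a \<Rightarrow> real"
  assumes R: "finite R" "\<And>x. x \<in> W \<Longrightarrow> \<phi> x \<in> R"
  shows "mean W (\<lambda>x. mean W (\<lambda>y. F x y * K (\<phi> x) (\<phi> y))) =
    (\<Sum>\<alpha>\<in>R. \<Sum>\<beta>\<in>R. K \<alpha> \<beta> * mean W (\<lambda>x. mean W (\<lambda>y. F x y * of_bool (\<phi> x = \<alpha> \<and> \<phi> y = \<beta>))))"
  unfolding mean_cmult[symmetric] mean_sum[symmetric]
proof (intro mean_cong)
  fix x y assume x: "x \<in> W" and y: "y \<in> W"
  have "(\<Sum>\<alpha>\<in>R. \<Sum>\<beta>\<in>R. K \<alpha> \<beta> * (F x y * of_bool (\<phi> x = \<alpha> \<and> \<phi> y = \<beta>))) =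
     (\<Sum>\<alpha>\<in>R. of_bool (\<alpha> = \<phi> x) * (\<Sum>\<beta>\<in>R. of_bool (\<beta> = \<phi> y) * (F x y * K \<alpha> \<beta>)))"
    unfolding sum_distrib_left by (intro sum.cong refl) auto
  also have "\<dots> = F x y * K (\<phi> x) (\<phi> y)"
    using R x y by (simp only: sum_delta_mult)
  finally show "F x y * K (\<phi> x) (\<phi> y) =
      (\<Sum>\<alpha>\<in>R. \<Sum>\<beta>\<in>R. K \<alpha> \<beta> * (F x y * of_bool (\<phi> x = \<alpha> \<and> \<phi> y = \<beta>)))" by simp
qed

definition edge_sig :: "('a \<Rightarrow> 'a \<Rightarrow> bool) \<Rightarrow> (nat \<Rightarrow> 'a) \<Rightarrow> nat \<Rightarrow> nat set \<Rightarrow> nat set \<Rightarrow> 'a \<Rightarrow> 'a \<Rightarrow> real" where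
  "edge_sig E t s \<alpha> \<beta> = (\<lambda>x y. of_bool (E x y) * of_bool (signature E t s x = \<alpha> \<and> signature E t s y = \<beta>))"

text \<open>No colouring occurs here, so one bound serves all colourings of the sample. The
  reference vertices are \<open>v (t r)\<close>, at positions \<open>t r\<close> of the sample
  itself.\<close>

definition transfer_err :: "'a set \<Rightarrow> ('a \<Rightarrow> 'a \<Rightarrow> bool) \<Rightarrow> 'i set \<Rightarrow> ('i \<Rightarrow> 'a) \<Rightarrow> (nat \<Rightarrow> 'i) \<Rightarrow> nat \<Rightarrow> real" where
  "transfer_err V E I v t s = (\<Sum>\<alpha>\<in>Pow {..<s}. \<Sum>\<beta>\<in>Pow {..<s}.
     \<bar>mean I (\<lambda>i. mean I (\<lambda>j. edge_sig E (v \<circ> t) s \<alpha> \<beta> (v i) (v j))) -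
      mean V (\<lambda>x. mean V (edge_sig E (v \<circ> t) s \<alpha> \<beta> x))\<bar>)"

text \<open>There are \<open>4 ^ s\<close> pairs of signatures. For each of them the tested relation
  depends on the sample only through its positions \<open>t r\<close> with \<open>r < s\<close>, so
  \<open>sample_deviation2\<close> applies with at most \<open>S\<close> frozen positions.\<close>

lemma mean_transfer_err:
  fixes I :: "'i set"
  assumes V: "finite V" "V \<noteq> {}" and I: "finite I" "I \<noteq> {}" and t: "t \<in> {..<S} \<rightarrow>\<^sub>E I" and s: "s < S"
  shows "mean (I \<rightarrow>\<^sub>E V) (\<lambda>v. transfer_err V E I v t s) \<le> 4 ^ S * (2 * sqrt ((real S + 2) / real (card I)))"
proof -
  let ?B = "2 * sqrt ((real S + 2) / real (card I))"
  have "mean (I \<rightarrow>\<^sub>E V) (\<lambda>v. transfer_err V E I v t s) =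
    (\<Sum>\<alpha>\<in>Pow {..<s}. \<Sum>\<beta>\<in>Pow {..<s}. mean (I \<rightarrow>\<^sub>E V) (\<lambda>v.
     \<bar>mean I (\<lambda>i. mean I (\<lambda>j. edge_sig E (v \<circ> t) s \<alpha> \<beta> (v i) (v j))) -
      mean V (\<lambda>x. mean V (edge_sig E (v \<circ> t) s \<alpha> \<beta> x))\<bar>))"
    unfolding transfer_err_def by (simp only: mean_sum)
  also have "\<dots> \<le> (\<Sum>\<alpha>\<in>Pow {..<s}. \<Sum>\<beta>\<in>Pow {..<s}. ?B)"
  proof (intro sum_mono sample_deviation2[OF V I, where J = "t ` {..<s}"])
    show "t ` {..<s} \<subseteq> I" using t s by (auto simp: PiE_iff)
    show "edge_sig E (v(i := x) \<circ> t) s \<alpha> \<beta> = edge_sig E (v \<circ> t) s \<alpha> \<beta>"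
      if "i \<in> I - t ` {..<s}" for v i x \<alpha> \<beta>
    proof -
      have "signature E (v(i := x) \<circ> t) s = signature E (v \<circ> t) s"
        using that by (auto simp: signature_def fun_eq_iff)
      then show ?thesis by (simp add: edge_sig_def fun_eq_iff)
    qed
    show "0 \<le> edge_sig E (v \<circ> t) s \<alpha> \<beta> x y \<and> edge_sig E (v \<circ> t) s \<alpha> \<beta> x y \<le> 1" for v x y \<alpha> \<beta>
      unfolding edge_sig_def of_bool_conj[symmetric] by simp
    have "card (t ` {..<s}) \<le> S" using card_image_le[of "{..<s}" t] s by simp
    then show "real (card (t ` {..<s})) \<le> real S" by simp
  qed
  also have "\<dots> = 4 ^ s * ?B"
    by (simp add: card_Pow power_mult_distrib[symmetric])
  also have "\<dots> \<le> 4 ^ S * ?B" using s by (intro mult_right_mono power_increasing) auto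
  finally show ?thesis .
qed

text \<open>The table \<open>P\<close> of class averages colours both the sample and
  \<open>V\<close>, since both are sorted by the same signatures. Its cost on either side is the
  same combination of densities between signature classes, so the two costs differ by at most
  \<open>transfer_err\<close>; on the sample it is controlled by
  \<open>frac_cost_cond_le\<close>.\<close>

lemma min_mono_density_le_sample:
  assumes V: "finite V" and I: "finite I" "I \<noteq> {}" and k: "k \<ge> 1" and \<eta>: "\<eta> > 0"
    and v: "v \<in> I \<rightarrow>\<^sub>E V"
    and sym: "\<And>x y. E x y = E y x" and irr: "\<And>x. \<not> E x x"
    and c: "\<And>i. i \<in> I \<Longrightarrow> c i < k"
  defines "A \<equiv> \<lambda>i j. E (v i) (v j)"
  shows "min_mono_density V E k \<le> mono_density I A c + real k * \<eta> + mean I (\<lambda>j. \<Sum>a<k. (discrepancy I A t s c a j)\<^sup>2) / \<eta> +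
    transfer_err V E I v t s"
proof -
  define x where "x = (\<lambda>a i. of_bool (c i = a) :: real)"
  define \<phi> where "\<phi> = signature E (v \<circ> t) s"
  have sgA: "signature A t s i = \<phi> (v i)" for i by (simp add: signature_def A_def \<phi>_def)
  \<comment> \<open>A signature that does not occur in the sample has no average; colour 0 serves as
    default, available because \<open>k \<ge> 1\<close>.\<close>
  define P where "P = (\<lambda>a \<sigma>. if \<exists>i\<in>I. \<phi> (v i) = \<sigma> then cond I (signature A t s) (x a) \<sigma> else of_bool (a = 0))"
  have P01: "0 \<le> P a \<sigma> \<and> P a \<sigma> \<le> 1" for a \<sigma>
    using I cond_bounds[OF I(1), of "x a" "signature A t s" \<sigma>] by (simp add: P_def x_def)
  have Psum: "(\<Sum>a<k. P a \<sigma>) = 1" for \<sigma>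
  proof (cases "\<exists>i\<in>I. \<phi> (v i) = \<sigma>")
    case True
    then have ne: "{j \<in> I. signature A t s j = \<sigma>} \<noteq> {}" by (auto simp: sgA)
    have "(\<Sum>a<k. P a \<sigma>) = mean {j \<in> I. signature A t s j = \<sigma>} (\<lambda>i. \<Sum>a<k. x a i)"
      using True by (simp only: P_def cond_def mean_sum if_True)
    also have "\<dots> = mean {j \<in> I. signature A t s j = \<sigma>} (\<lambda>i. 1)"
    proof (rule mean_cong)
      fix i assume "i \<in> {j \<in> I. signature A t s j = \<sigma>}"
      then have "c i < k" using c by auto
      then have "(\<Sum>a<k. of_bool (a = c i) * 1) = (1::real)" by (intro sum_delta_mult) auto
      moreover have "x a i = of_bool (a = c i) * 1" for a by (auto simp: x_def)
      ultimately show "(\<Sum>a<k. x a i) = 1" by (simp only:)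
    qed
    also have "\<dots> = 1" using ne I by (intro mean_const) auto
    finally show ?thesis .
  next
    case False
    then have "(\<Sum>a<k. P a \<sigma>) = (\<Sum>a<k. of_bool (a = 0) * 1)" by (simp only: P_def if_False mult_1_right)
    also have "\<dots> = 1" using k by (intro sum_delta_mult) auto
    finally show ?thesis .
  qed
  define K where "K = (\<lambda>\<alpha> \<beta>. \<Sum>a<k. P a \<alpha> * P a \<beta>)"
  have Keq: "(\<Sum>a<k. P a \<alpha> * P a \<beta>) = K \<alpha> \<beta>" for \<alpha> \<beta> by (simp add: K_def)
  have K01: "\<bar>K \<alpha> \<beta>\<bar> \<le> 1" for \<alpha> \<beta>
  proof -
    have "K \<alpha> \<beta> \<le> (\<Sum>a<k. P a \<alpha> * 1)" unfolding K_def using P01 by (intro sum_mono mult_left_mono) auto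
    moreover have "0 \<le> K \<alpha> \<beta>" unfolding K_def using P01 by (intro sum_nonneg) auto
    ultimately show ?thesis using Psum by simp
  qed
  define eV where "eV = (\<lambda>\<alpha> \<beta>. mean V (\<lambda>x. mean V (edge_sig E (v \<circ> t) s \<alpha> \<beta> x)))"
  define eI where "eI = (\<lambda>\<alpha> \<beta>. mean I (\<lambda>i. mean I (\<lambda>j. edge_sig E (v \<circ> t) s \<alpha> \<beta> (v i) (v j))))"
  have "min_mono_density V E k \<le> frac_cost V E k (\<lambda>x a. P a (\<phi> x))"
    using V irr P01 Psum by (intro rounding) (auto simp: frac_colouring_def)
  also have "\<dots> = (\<Sum>\<alpha>\<in>Pow {..<s}. \<Sum>\<beta>\<in>Pow {..<s}. K \<alpha> \<beta> * eV \<alpha> \<beta>)"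
    unfolding frac_cost_def eV_def edge_sig_def Keq \<phi>_def[symmetric]
    by (rule mean_mean_signature) (auto simp: \<phi>_def signature_def)
  also have "\<dots> \<le> (\<Sum>\<alpha>\<in>Pow {..<s}. \<Sum>\<beta>\<in>Pow {..<s}. K \<alpha> \<beta> * eI \<alpha> \<beta> + \<bar>eI \<alpha> \<beta> - eV \<alpha> \<beta>\<bar>)"
  proof (intro sum_mono)
    fix \<alpha> \<beta>
    have "K \<alpha> \<beta> * (eV \<alpha> \<beta> - eI \<alpha> \<beta>) \<le> \<bar>K \<alpha> \<beta> * (eV \<alpha> \<beta> - eI \<alpha> \<beta>)\<bar>" by (rule abs_ge_self)
    also have "\<dots> \<le> 1 * \<bar>eV \<alpha> \<beta> - eI \<alpha> \<beta>\<bar>"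
      unfolding abs_mult by (intro mult_right_mono K01) auto
    finally have "K \<alpha> \<beta> * (eV \<alpha> \<beta> - eI \<alpha> \<beta>) \<le> \<bar>eI \<alpha> \<beta> - eV \<alpha> \<beta>\<bar>"
      by (simp only: abs_minus_commute mult_1_left)
    then show "K \<alpha> \<beta> * eV \<alpha> \<beta> \<le> K \<alpha> \<beta> * eI \<alpha> \<beta> + \<bar>eI \<alpha> \<beta> - eV \<alpha> \<beta>\<bar>"
      by (simp add: right_diff_distrib)
  qed
  also have "\<dots> = (\<Sum>\<alpha>\<in>Pow {..<s}. \<Sum>\<beta>\<in>Pow {..<s}. K \<alpha> \<beta> * eI \<alpha> \<beta>) + transfer_err V E I v t s"
    by (simp only: sum.distrib transfer_err_def eI_def eV_def)
  also have "(\<Sum>\<alpha>\<in>Pow {..<s}. \<Sum>\<beta>\<in>Pow {..<s}. K \<alpha> \<beta> * eI \<alpha> \<beta>) = frac_cost I A k (\<lambda>i a. P a (\<phi> (v i)))"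
    unfolding frac_cost_def eI_def edge_sig_def Keq \<phi>_def[symmetric] A_def
    by (rule mean_mean_signature[where \<phi> = "\<lambda>i. \<phi> (v i)", symmetric]) (auto simp: \<phi>_def signature_def)
  also have "\<dots> = frac_cost I A k (\<lambda>i a. cond I (signature A t s) (\<lambda>i. of_bool (c i = a)) (signature A t s i))"
    unfolding frac_cost_def
  proof (intro mean_cong)
    fix i j assume "i \<in> I" "j \<in> I"
    then have "P a (\<phi> (v i)) = cond I (signature A t s) (\<lambda>i. of_bool (c i = a)) (signature A t s i)"
       "P a (\<phi> (v j)) = cond I (signature A t s) (\<lambda>i. of_bool (c i = a)) (signature A t s j)" for a
      by (auto simp: P_def sgA x_def)
    then show "of_bool (A i j) * (\<Sum>a<k. P a (\<phi> (v i)) * P a (\<phi> (v j))) = of_bool (A i j) *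
         (\<Sum>a<k. cond I (signature A t s) (\<lambda>i. of_bool (c i = a)) (signature A t s i) *
                cond I (signature A t s) (\<lambda>i. of_bool (c i = a)) (signature A t s j))" by simp
  qed
  also have "\<dots> \<le> mono_density I A c + real k * \<eta> + mean I (\<lambda>j. \<Sum>a<k. (discrepancy I A t s c a j)\<^sup>2) / \<eta>"
    using sym by (intro frac_cost_cond_le[OF I c \<eta>]) (auto simp: A_def)
  finally show ?thesis by simp
qed

text \<open>Instead of selecting a good \<open>s\<close> and good reference positions, the bound is
  averaged over all \<open>t\<close> and summed over \<open>s < S\<close>. The discrepancies then
  add up to at most 1, and division by \<open>S\<close> leaves
  \<open>1 / (\<eta> * real S)\<close>.\<close>

lemma min_mono_density_le_mean_sample:
  fixes I :: "'i set"
  assumes V: "finite V" "V \<noteq> {}" and I: "finite I" "I \<noteq> {}" and k: "k \<ge> 1" and \<eta>: "\<eta> > 0" and S: "S > 0"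
    and sym: "\<And>x y. E x y = E y x" and irr: "\<And>x. \<not> E x x"
  shows "min_mono_density V E k \<le> mean (I \<rightarrow>\<^sub>E V) (\<lambda>v. min_mono_density I (\<lambda>i j. E (v i) (v j)) k) + real k * \<eta> + 1 / (\<eta> * real S) +
    4 ^ S * (2 * sqrt ((real S + 2) / real (card I)))"
proof -
  let ?X = "I \<rightarrow>\<^sub>E V" and ?T = "{..<S} \<rightarrow>\<^sub>E I"
  let ?B = "4 ^ S * (2 * sqrt ((real S + 2) / real (card I)))"
  have X: "finite ?X" "?X \<noteq> {}" and T: "finite ?T" "?T \<noteq> {}"
    using V I by (auto simp: finite_PiE PiE_eq_empty_iff)
  define err where "err = (\<lambda>v. \<Sum>s<S. mean ?T (\<lambda>t. transfer_err V E I v t s))"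
  \<comment> \<open>The minimiser \<open>c\<close> below may depend on \<open>v\<close>, as the
    discrepancy bound holds for each colouring of the sample separately.\<close>
  have pt: "real S * min_mono_density V E k \<le> real S * min_mono_density I (\<lambda>i j. E (v i) (v j)) k + real S * (real k * \<eta>) + 1 / \<eta> + err v"
    if v: "v \<in> ?X" for v
  proof -
    define A where "A = (\<lambda>i j. E (v i) (v j))"
    obtain c where c: "\<And>i. i \<in> I \<Longrightarrow> c i < k" "mono_density I A c = min_mono_density I A k"
      using min_mono_density_attained[OF I(1) k] by blast
    define Q where "Q = (\<lambda>t s. mean I (\<lambda>j. \<Sum>a<k. (discrepancy I A t s c a j)\<^sup>2))"
    have "min_mono_density V E k \<le> (min_mono_density I A k + real k * \<eta>) + mean ?T (\<lambda>t. Q t s) / \<eta> + mean ?T (\<lambda>t. transfer_err V E I v t s)" for s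
    proof -
      have "mean ?T (\<lambda>t. min_mono_density V E k) \<le> mean ?T (\<lambda>t. (min_mono_density I A k + real k * \<eta>) + Q t s * (1 / \<eta>) + transfer_err V E I v t s)"
      proof (rule mean_mono)
        fix t
        show "min_mono_density V E k \<le> (min_mono_density I A k + real k * \<eta>) + Q t s * (1 / \<eta>) + transfer_err V E I v t s"
          using min_mono_density_le_sample[where V = V and I = I and E = E and v = v and c = c and k = k and \<eta> = \<eta> and t = t and s = s]
            V I k \<eta> v sym irr c by (simp add: Q_def A_def)
      qed
      then show ?thesis unfolding mean_add mean_multc mean_const[OF T] by simp
    qed
    then have "(\<Sum>s<S. min_mono_density V E k) \<le> (\<Sum>s<S. (min_mono_density I A k + real k * \<eta>) + mean ?T (\<lambda>t. Q t s) / \<eta> +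
        mean ?T (\<lambda>t. transfer_err V E I v t s))" by (intro sum_mono)
    then have "real S * min_mono_density V E k \<le> real S * (min_mono_density I A k + real k * \<eta>) + (\<Sum>s<S. mean ?T (\<lambda>t. Q t s)) / \<eta> + err v"
      by (simp add: sum.distrib sum_divide_distrib err_def)
    also have "(\<Sum>s<S. mean ?T (\<lambda>t. Q t s)) / \<eta> \<le> 1 / \<eta>"
      using mean_discrepancy_le_one[OF I, where c = c and k = k] c(1) \<eta> unfolding Q_def by (intro divide_right_mono) simp_all
    finally show ?thesis unfolding A_def by (simp add: distrib_left)
  qed
  have "real S * min_mono_density V E k = mean ?X (\<lambda>v. real S * min_mono_density V E k)" using X by (simp add: mean_const)
  also have "\<dots> \<le> mean ?X (\<lambda>v. real S * min_mono_density I (\<lambda>i j. E (v i) (v j)) k + (real S * (real k * \<eta>) + 1 / \<eta>) + err v)"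
    using pt by (intro mean_mono) (simp add: add.assoc)
  also have "\<dots> = real S * mean ?X (\<lambda>v. min_mono_density I (\<lambda>i j. E (v i) (v j)) k) + (real S * (real k * \<eta>) + 1 / \<eta>) + mean ?X err"
    by (simp only: mean_add mean_cmult mean_const[OF X])
  also have "mean ?X err = (\<Sum>s<S. mean ?T (\<lambda>t. mean ?X (\<lambda>v. transfer_err V E I v t s)))"
    unfolding err_def mean_sum by (intro sum.cong refl mean_swap)
  also have "\<dots> \<le> (\<Sum>s<S. ?B)"
    using mean_transfer_err[OF V I] by (intro sum_mono mean_le_const[OF T]) auto
  finally have "real S * min_mono_density V E k \<le> real S * (mean ?X (\<lambda>v. min_mono_density I (\<lambda>i j. E (v i) (v j)) k) + real k * \<eta> + 1 / (\<eta> * real S) + ?B)"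
    using S by (simp add: distrib_left mult.assoc[symmetric])
  then show ?thesis using S by simp
qed

text \<open>Each of the three errors is made at most \<open>\<epsilon> / 3\<close> by the choice of
  \<open>\<eta>\<close>, then \<open>S\<close>, then \<open>m\<close>; none of these depends on
  \<open>V\<close> or \<open>E\<close>.\<close>

theorem sampling:
  assumes k: "k \<ge> 1" and \<epsilon>: "\<epsilon> > 0"
  obtains m :: nat where "m \<ge> 1"
    "\<And>V (E :: 'a \<Rightarrow> 'a \<Rightarrow> bool). finite V \<Longrightarrow> V \<noteq> {} \<Longrightarrow> (\<And>x y. E x y = E y x) \<Longrightarrow> (\<And>x. \<not> E x x) \<Longrightarrow>
      min_mono_density V E k \<le> mean ({..<m} \<rightarrow>\<^sub>E V) (\<lambda>v. min_mono_density {..<m} (\<lambda>i j. E (v i) (v j)) k) + \<epsilon>"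
proof -
  define \<eta> where "\<eta> = \<epsilon> / (3 * real k)"
  have \<eta>: "\<eta> > 0" using k \<epsilon> by (simp add: \<eta>_def)
  obtain S where S: "3 / (\<eta> * \<epsilon>) < real S" using reals_Archimedean2 by blast
  have "0 < 3 / (\<eta> * \<epsilon>)" using \<eta> \<epsilon> by simp
  then have S0: "S > 0" using S by (metis gr0I less_asym of_nat_0)
  have S1: "1 / (\<eta> * real S) \<le> \<epsilon> / 3" using S S0 \<eta> \<epsilon> by (simp add: field_simps)
  \<comment> \<open>Chosen so that \<open>4 ^ S * 2 / B = \<epsilon> / 3\<close>; a large
    \<open>m\<close> then makes the square root at most \<open>1 / B\<close>.\<close>
  define B where "B = 6 * 4 ^ S / \<epsilon>"
  have B: "B > 0" using \<epsilon> by (simp add: B_def)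
  obtain m where m: "(real S + 2) * B\<^sup>2 < real m" using reals_Archimedean2 by blast
  have "0 \<le> (real S + 2) * B\<^sup>2" by simp
  then have m0: "m > 0" using m by (metis gr0I not_less of_nat_0)
  have "(real S + 2) / real m \<le> (1 / B)\<^sup>2"
    using m m0 B by (simp add: field_simps power2_eq_square)
  then have "sqrt ((real S + 2) / real m) \<le> 1 / B"
    using B by (intro real_le_lsqrt) auto
  then have "4 ^ S * (2 * sqrt ((real S + 2) / real m)) \<le> 4 ^ S * (2 * (1 / B))"
    by (intro mult_left_mono) auto
  also have "\<dots> = \<epsilon> / 3" using \<epsilon> by (simp add: B_def)
  finally have 3: "4 ^ S * (2 * sqrt ((real S + 2) / real m)) \<le> \<epsilon> / 3" .
  have 1: "real k * \<eta> = \<epsilon> / 3" using k by (simp add: \<eta>_def)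
  show ?thesis
  proof (rule that[of m])
    fix V :: "'a set" and E :: "'a \<Rightarrow> 'a \<Rightarrow> bool"
    assume VE: "finite V" "V \<noteq> {}" "\<And>x y. E x y = E y x" "\<And>x. \<not> E x x"
    have "min_mono_density V E k \<le> mean ({..<m} \<rightarrow>\<^sub>E V) (\<lambda>v. min_mono_density {..<m} (\<lambda>i j. E (v i) (v j)) k) + real k * \<eta> +
        1 / (\<eta> * real S) + 4 ^ S * (2 * sqrt ((real S + 2) / real (card {..<m})))"
      using m0 by (intro min_mono_density_le_mean_sample VE \<eta> S0 k) auto
    then show "min_mono_density V E k \<le> mean ({..<m} \<rightarrow>\<^sub>E V) (\<lambda>v. min_mono_density {..<m} (\<lambda>i j. E (v i) (v j)) k) + \<epsilon>"
      using 1 S1 3 by simp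
  qed (use m0 in simp)
qed

section \<open>Even wheels force few triangles\<close>

definition tri_dens :: "'a set \<Rightarrow> ('a \<Rightarrow> 'a \<Rightarrow> bool) \<Rightarrow> real" where
  "tri_dens V E = mean V (\<lambda>x. mean V (\<lambda>y. mean V (\<lambda>z. of_bool (E x y \<and> E x z \<and> E y z))))"

text \<open>Jensen's inequality, first in one side of the biclique and then in the other.\<close>

lemma biclique_density:
  assumes V: "finite V" "V \<noteq> {}" and T: "\<And>y z. 0 \<le> T y z"
  shows "mean V (\<lambda>y. mean V (\<lambda>z. T y z)) ^ (r * r) \<le>
    mean ({..<r} \<rightarrow>\<^sub>E V) (\<lambda>b. mean ({..<r} \<rightarrow>\<^sub>E V) (\<lambda>a. \<Prod>i<r. \<Prod>j<r. T (a i) (b j)))"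
proof -
  let ?P = "{..<r} \<rightarrow>\<^sub>E V"
  have P: "finite ?P" "?P \<noteq> {}" using V by (auto simp: finite_PiE PiE_eq_empty_iff)
  have "mean V (\<lambda>y. mean V (\<lambda>z. T y z)) ^ r \<le> mean V (\<lambda>y. mean V (\<lambda>z. T y z) ^ r)"
    using V T by (intro mean_power_le mean_nonneg) auto
  also have "\<dots> = mean V (\<lambda>y. mean ?P (\<lambda>b. \<Prod>j<r. T y (b j)))"
    using mean_PiE_prod[of "{..<r}" V] V by simp
  also have "\<dots> = mean ?P (\<lambda>b. mean V (\<lambda>y. \<Prod>j<r. T y (b j)))" by (rule mean_swap)
  finally have "(mean V (\<lambda>y. mean V (\<lambda>z. T y z)) ^ r) ^ r \<le> (mean ?P (\<lambda>b. mean V (\<lambda>y. \<Prod>j<r. T y (b j)))) ^ r"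
    using T by (intro power_mono zero_le_power mean_nonneg) auto
  also have "\<dots> \<le> mean ?P (\<lambda>b. mean V (\<lambda>y. \<Prod>j<r. T y (b j)) ^ r)"
    using P T by (intro mean_power_le mean_nonneg prod_nonneg) auto
  also have "\<dots> = mean ?P (\<lambda>b. mean ?P (\<lambda>a. \<Prod>i<r. \<Prod>j<r. T (a i) (b j)))"
  proof (rule mean_cong)
    fix b :: "nat \<Rightarrow> 'a"
    show "mean V (\<lambda>y. \<Prod>j<r. T y (b j)) ^ r = mean ?P (\<lambda>a. \<Prod>i<r. \<Prod>j<r. T (a i) (b j))"
      using mean_PiE_prod[of "{..<r}" V "\<lambda>y. \<Prod>j<r. T y (b j)"] V by simp
  qed
  finally show ?thesis by (simp add: power_mult)
qed

text \<open>Union bound over ordered pairs of positions, each colliding with probability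
  \<open>1 / card V\<close>.\<close>

lemma mean_not_inj_le:
  assumes V: "finite V" "V \<noteq> {}"
  shows "mean ({..<r} \<rightarrow>\<^sub>E V) (\<lambda>a. of_bool (\<not> inj_on a {..<r})) \<le> (real r)\<^sup>2 / real (card V)"
proof -
  let ?P = "{..<r} \<rightarrow>\<^sub>E V"
  have P: "finite ?P" "?P \<noteq> {}" using V by (auto simp: finite_PiE PiE_eq_empty_iff)
  have "mean ?P (\<lambda>a. of_bool (\<not> inj_on a {..<r})) \<le> mean ?P (\<lambda>a. \<Sum>i<r. \<Sum>j<r. of_bool (i \<noteq> j \<and> a i = a j))"
  proof (rule mean_mono)
    fix a :: "nat \<Rightarrow> 'a"
    show "of_bool (\<not> inj_on a {..<r}) \<le> (\<Sum>i<r. \<Sum>j<r. of_bool (i \<noteq> j \<and> a i = a j) :: real)"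
    proof (cases "inj_on a {..<r}")
      case False
      then obtain i j where ij: "i < r" "j < r" "i \<noteq> j" "a i = a j" by (auto simp: inj_on_def)
      have "1 = (of_bool (i \<noteq> j \<and> a i = a j) :: real)" using ij by simp
      also have "\<dots> \<le> (\<Sum>j<r. of_bool (i \<noteq> j \<and> a i = a j))"
        by (rule member_le_sum[where f = "\<lambda>j. of_bool (i \<noteq> j \<and> a i = a j)"]) (use ij in auto)
      also have "\<dots> \<le> (\<Sum>i<r. \<Sum>j<r. of_bool (i \<noteq> j \<and> a i = a j))"
        by (rule member_le_sum[where f = "\<lambda>i. \<Sum>j<r. of_bool (i \<noteq> j \<and> a i = a j)"])
           (use ij in \<open>auto intro: sum_nonneg\<close>)
      finally show ?thesis by simp
    qed (simp add: sum_nonneg)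
  qed
  also have "\<dots> = (\<Sum>i<r. \<Sum>j<r. mean ?P (\<lambda>a. of_bool (i \<noteq> j \<and> a i = a j)))"
    by (simp only: mean_sum)
  also have "\<dots> \<le> (\<Sum>i<r. \<Sum>j<r. 1 / real (card V))"
  proof (intro sum_mono)
    fix i j assume i: "i \<in> {..<r}" and j: "j \<in> {..<r}"
    show "mean ?P (\<lambda>a. of_bool (i \<noteq> j \<and> a i = a j)) \<le> 1 / real (card V)"
    proof (cases "i = j")
      case True
      then show ?thesis using P by (simp add: mean_const)
    next
      case False
      have "mean ?P (\<lambda>a. of_bool (i \<noteq> j \<and> a i = a j)) =
          mean ?P (\<lambda>a. mean V (\<lambda>x. of_bool (i \<noteq> j \<and> (a(i := x)) i = (a(i := x)) j)))"
        using V i by (intro mean_PiE_resample) auto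
      also have "\<dots> = mean ?P (\<lambda>a. 1 / real (card V))"
      proof (rule mean_cong)
        fix a assume "a \<in> ?P"
        then have "a j \<in> V" using j by (auto simp: PiE_iff)
        have "mean V (\<lambda>x. of_bool (i \<noteq> j \<and> (a(i := x)) i = (a(i := x)) j)) =
            mean V (\<lambda>x. of_bool (x = a j) * 1)" using False by (intro mean_cong) simp
        also have "\<dots> = 1 / real (card V)"
          unfolding mean_def using V(1) \<open>a j \<in> V\<close> by (simp only: sum_delta_mult)
        finally show "mean V (\<lambda>x. of_bool (i \<noteq> j \<and> (a(i := x)) i = (a(i := x)) j)) = 1 / real (card V)" .
      qed
      also have "\<dots> = 1 / real (card V)" using P by (rule mean_const)
      finally show ?thesis by simp
    qed
  qed
  also have "\<dots> = (real r)\<^sup>2 / real (card V)" by (simp add: power2_eq_square)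
  finally show ?thesis .
qed

text \<open>Rim positions alternate between the sides \<open>a\<close> and \<open>b\<close> of the
  biclique. Adjacent vertices are distinct, so injectivity needs an argument only for two rim
  positions of equal parity, where \<open>a\<close> or \<open>b\<close> is injective.\<close>

lemma contains_wheel:
  assumes G: "simple_graph G" and r: "r \<ge> 2" and x: "x \<in> vertex_set G"
    and a: "inj_on a {..<r}" and b: "inj_on b {..<r}"
    and adj: "\<And>i j. i < r \<Longrightarrow> j < r \<Longrightarrow> adj G x (a i) \<and> adj G x (b j) \<and> adj G (a i) (b j)"
  shows "contains_graph G (wheel (2 * r))"
proof -
  define f where "f = (\<lambda>i. if i = 2 * r then x else if even i then a (i div 2) else b (i div 2))"
  have half: "i div 2 < r" if "i < 2 * r" for i using that by linarith
  have hub: "adj G x (f i)" if "i < 2 * r" for i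
    using that adj half[OF that] by (auto simp: f_def)
  have rim: "adj G (f i) (f j)" if "i < 2 * r" "j < 2 * r" "even i \<noteq> even j" for i j
  proof (cases "even i")
    case True
    then show ?thesis using that adj[of "i div 2" "j div 2"] half by (simp add: f_def)
  next
    case False
    then show ?thesis using that adj[of "j div 2" "i div 2"] half by (simp add: f_def adj_sym[of G "b _"])
  qed
  have ne: "f i \<noteq> f j" if ij: "i \<le> 2 * r" "j \<le> 2 * r" "i < j" for i j
  proof (cases "j = 2 * r")
    case True
    then have "adj G x (f i)" "f j = x" using hub[of i] ij by (auto simp: f_def)
    then show ?thesis using adj_in[OF G, of x "f i"] by auto
  next
    case False
    show ?thesis
    proof (cases "even i = even j")
      case True
      then have "i mod 2 = j mod 2" by (simp add: mod2_eq_if)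
      then have "i div 2 \<noteq> j div 2" using ij(3) by (metis div_mult_mod_eq less_irrefl)
      moreover have "i < 2 * r" "j < 2 * r" using ij False by auto
      then have "i div 2 \<in> {..<r}" "j div 2 \<in> {..<r}" using half by auto
      ultimately have "a (i div 2) \<noteq> a (j div 2)" "b (i div 2) \<noteq> b (j div 2)"
        using inj_on_eq_iff[OF a] inj_on_eq_iff[OF b] by blast+
      then show ?thesis using True False ij by (simp add: f_def)
    next
      case parity: False
      then have "adj G (f i) (f j)" using False ij by (intro rim) auto
      then show ?thesis using adj_in[OF G] by blast
    qed
  qed
  have "inj_on f (vertex_set (wheel (2 * r)))"
  proof (rule inj_onI)
    fix i j assume "i \<in> vertex_set (wheel (2 * r))" "j \<in> vertex_set (wheel (2 * r))" "f i = f j"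
    then show "i = j" using ne[of i j] ne[of j i] by (cases i j rule: linorder_cases) (auto simp: wheel_def)
  qed
  moreover have "f ` vertex_set (wheel (2 * r)) \<subseteq> vertex_set G"
  proof
    fix y assume "y \<in> f ` vertex_set (wheel (2 * r))"
    then obtain i where i: "i \<le> 2 * r" "y = f i" by (auto simp: wheel_def)
    show "y \<in> vertex_set G"
      using i x adj_in[OF G hub[of i]] by (cases "i = 2 * r") (auto simp: f_def)
  qed
  moreover have "f ` e \<in> edge_set G" if "e \<in> edge_set (wheel (2 * r))" for e
  proof -
    from that consider i where "i < 2 * r" "e = {i, (i + 1) mod (2 * r)}" | i where "i < 2 * r" "e = {i, 2 * r}"
      by (auto simp: wheel_def)
    then show ?thesis
    proof cases
      case 1
      \<comment> \<open>The modulus is even, so parity also alternates at the closing edge of the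
        rim.\<close>
      have "even ((i + 1) mod (2 * r)) = even (i + 1)"
        by (metis dvd_mod_iff dvd_triv_left)
      then have "adj G (f i) (f ((i + 1) mod (2 * r)))" using 1 r by (intro rim) auto
      then show ?thesis using 1 by (simp add: adj_def)
    next
      case 2
      have "f (2 * r) = x" by (simp add: f_def)
      then have "f ` e = {x, f i}" unfolding 2(2) image_insert image_empty by (simp only: insert_commute)
      then show ?thesis using hub[OF 2(1)] by (simp add: adj_def)
    qed
  qed
  ultimately show ?thesis unfolding contains_graph_def by blast
qed

text \<open>For a fixed hub \<open>x\<close>, \<open>biclique_density\<close> counts homomorphisms
  of K(r,r) into the neighbourhood of \<open>x\<close>. Wheel-freeness leaves only degenerate ones,
  where one side repeats a vertex. A further Jensen step averages over \<open>x\<close>.\<close>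

lemma wheel_free_tri_dens:
  assumes G: "simple_graph G" and V: "vertex_set G \<noteq> {}" and r: "r \<ge> 2" and free: "H_free (wheel (2 * r)) G"
  shows "tri_dens (vertex_set G) (adj G) ^ (r * r) \<le> 2 * (real r)\<^sup>2 / real (card (vertex_set G))"
proof -
  define V where "V = vertex_set G"
  have V: "finite V" "V \<noteq> {}" using G V by (auto simp: V_def simple_graph_def)
  let ?P = "{..<r} \<rightarrow>\<^sub>E V"
  have P: "finite ?P" "?P \<noteq> {}" using V by (auto simp: finite_PiE PiE_eq_empty_iff)
  define T where "T = (\<lambda>x y z. of_bool (adj G x y \<and> adj G x z \<and> adj G y z) :: real)"
  have "tri_dens V (adj G) ^ (r * r) \<le> mean V (\<lambda>x. mean V (\<lambda>y. mean V (\<lambda>z. T x y z)) ^ (r * r))"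
    unfolding tri_dens_def T_def using V by (intro mean_power_le mean_nonneg) auto
  also have "\<dots> \<le> mean V (\<lambda>x. 2 * (real r)\<^sup>2 / real (card V))"
  proof (rule mean_mono)
    fix x assume x: "x \<in> V"
    have "mean V (\<lambda>y. mean V (\<lambda>z. T x y z)) ^ (r * r) \<le>
        mean ?P (\<lambda>b. mean ?P (\<lambda>a. \<Prod>i<r. \<Prod>j<r. T x (a i) (b j)))"
      using V by (intro biclique_density) (auto simp: T_def)
    also have "\<dots> \<le> mean ?P (\<lambda>b. mean ?P (\<lambda>a. of_bool (\<not> inj_on a {..<r}) + of_bool (\<not> inj_on b {..<r})))"
    proof (intro mean_mono)
      fix b a
      show "(\<Prod>i<r. \<Prod>j<r. T x (a i) (b j)) \<le> of_bool (\<not> inj_on a {..<r}) + of_bool (\<not> inj_on b {..<r})"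
      proof (cases "inj_on a {..<r} \<and> inj_on b {..<r}")
        case True
        have "\<exists>i<r. \<exists>j<r. T x (a i) (b j) = 0"
        proof (rule ccontr)
          assume "\<not> ?thesis"
          then have "contains_graph G (wheel (2 * r))"
            using True x by (intro contains_wheel[OF G r, of x a b]) (auto simp: T_def V_def)
          with free show False by (simp add: H_free_def)
        qed
        then obtain i j where ij: "i < r" "j < r" "T x (a i) (b j) = 0" by auto
        then have "(\<Prod>i<r. \<Prod>j<r. T x (a i) (b j)) = 0" by simp blast
        moreover have "(0::real) \<le> of_bool (\<not> inj_on a {..<r}) + of_bool (\<not> inj_on b {..<r})"
          by (simp add: of_bool_def)
        ultimately show ?thesis by (simp only:)
      next
        case False
        have "(\<Prod>i<r. \<Prod>j<r. T x (a i) (b j)) \<le> 1"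
          by (intro prod_le_1 conjI prod_nonneg) (auto simp: T_def)
        also have "1 \<le> (of_bool (\<not> inj_on a {..<r}) + of_bool (\<not> inj_on b {..<r}) :: real)" using False by auto
        finally show ?thesis .
      qed
    qed
    also have "\<dots> = 2 * mean ?P (\<lambda>a. of_bool (\<not> inj_on a {..<r}))"
      by (simp only: mean_add mean_const[OF P])
    also have "\<dots> \<le> 2 * ((real r)\<^sup>2 / real (card V))"
      using mean_not_inj_le[OF V, of r] by simp
    finally show "mean V (\<lambda>y. mean V (\<lambda>z. T x y z)) ^ (r * r) \<le> 2 * (real r)\<^sup>2 / real (card V)" by simp
  qed
  also have "\<dots> = 2 * (real r)\<^sup>2 / real (card V)" using V by (rule mean_const)
  finally show ?thesis by (simp add: V_def)
qed

text \<open>Union bound over \<open>m ^ 3\<close> triples of positions: for distinct positions the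
  probability is \<open>tri_dens V E\<close>, and a repeated position cannot give a triangle by
  irreflexivity.\<close>

lemma mean_sample_triangle:
  assumes V: "finite V" "V \<noteq> {}" and irr: "\<And>x. \<not> E x x"
  shows "mean ({..<m} \<rightarrow>\<^sub>E V) (\<lambda>v. of_bool (\<exists>i<m. \<exists>j<m. \<exists>l<m. E (v i) (v j) \<and> E (v i) (v l) \<and> E (v j) (v l)))
    \<le> real m ^ 3 * tri_dens V E"
proof -
  let ?P = "{..<m} \<rightarrow>\<^sub>E V"
  define T where "T = (\<lambda>x y z. of_bool (E x y \<and> E x z \<and> E y z) :: real)"
  have T0: "0 \<le> T x y z" for x y z by (simp add: T_def)
  have P: "finite ?P" "?P \<noteq> {}" using V by (auto simp: finite_PiE PiE_eq_empty_iff)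
  have "mean ?P (\<lambda>v. of_bool (\<exists>i<m. \<exists>j<m. \<exists>l<m. E (v i) (v j) \<and> E (v i) (v l) \<and> E (v j) (v l))) \<le>
      mean ?P (\<lambda>v. \<Sum>i<m. \<Sum>j<m. \<Sum>l<m. T (v i) (v j) (v l))"
  proof (rule mean_mono)
    fix v
    show "of_bool (\<exists>i<m. \<exists>j<m. \<exists>l<m. E (v i) (v j) \<and> E (v i) (v l) \<and> E (v j) (v l)) \<le>
        (\<Sum>i<m. \<Sum>j<m. \<Sum>l<m. T (v i) (v j) (v l))"
    proof (cases "\<exists>i<m. \<exists>j<m. \<exists>l<m. E (v i) (v j) \<and> E (v i) (v l) \<and> E (v j) (v l)")
      case True
      then obtain i j l where ijl: "i < m" "j < m" "l < m" "E (v i) (v j)" "E (v i) (v l)" "E (v j) (v l)" by auto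
      have "1 = T (v i) (v j) (v l)" using ijl by (simp add: T_def)
      also have "\<dots> \<le> (\<Sum>l<m. T (v i) (v j) (v l))"
        using ijl T0 by (intro member_le_sum[where f = "\<lambda>l. T (v i) (v j) (v l)"]) auto
      also have "\<dots> \<le> (\<Sum>j<m. \<Sum>l<m. T (v i) (v j) (v l))"
        using ijl T0 by (intro member_le_sum[where f = "\<lambda>j. \<Sum>l<m. T (v i) (v j) (v l)"] sum_nonneg) auto
      also have "\<dots> \<le> (\<Sum>i<m. \<Sum>j<m. \<Sum>l<m. T (v i) (v j) (v l))"
        using ijl T0 by (intro member_le_sum[where f = "\<lambda>i. \<Sum>j<m. \<Sum>l<m. T (v i) (v j) (v l)"] sum_nonneg) auto
      finally show ?thesis using True by (simp only: of_bool_eq)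
    next
      case False
      then show ?thesis using T0 by (simp only: of_bool_eq) (intro sum_nonneg T0)
    qed
  qed
  also have "\<dots> = (\<Sum>i<m. \<Sum>j<m. \<Sum>l<m. mean ?P (\<lambda>v. T (v i) (v j) (v l)))"
    by (simp only: mean_sum)
  also have "\<dots> \<le> (\<Sum>i<m. \<Sum>j<m. \<Sum>l<m. tri_dens V E)"
  proof (intro sum_mono)
    fix i j l assume ijl: "i \<in> {..<m}" "j \<in> {..<m}" "l \<in> {..<m}"
    have t0: "0 \<le> tri_dens V E" unfolding tri_dens_def by (intro mean_nonneg) simp
    show "mean ?P (\<lambda>v. T (v i) (v j) (v l)) \<le> tri_dens V E"
    proof (cases "i \<noteq> j \<and> i \<noteq> l \<and> j \<noteq> l")
      case True
      have "mean ?P (\<lambda>v. T (v i) (v j) (v l)) = mean ?P (\<lambda>v. mean V (\<lambda>z. T (v i) (v j) z))"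
        using V True by (subst mean_PiE_resample[OF V ijl(3)]) auto
      also have "\<dots> = mean ?P (\<lambda>v. mean V (\<lambda>y. mean V (\<lambda>z. T (v i) y z)))"
        using V True by (subst mean_PiE_resample[OF V ijl(2)]) auto
      also have "\<dots> = tri_dens V E"
        unfolding tri_dens_def T_def using V ijl by (intro mean_PiE_point) auto
      finally show ?thesis by simp
    next
      case False
      then have "T (v i) (v j) (v l) = 0" for v using irr by (auto simp: T_def)
      then show ?thesis using t0 P by (simp add: mean_const)
    qed
  qed
  also have "\<dots> = real m ^ 3 * tri_dens V E" by (simp add: power3_eq_cube)
  finally show ?thesis .
qed

section \<open>Comparison of the two extremal functions\<close>

lemma wheel_edges: "edge_set (wheel l) \<noteq> {}" if "l > 0"
  using that by (auto simp: wheel_def)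

lemma h_max_wheel_le:
  assumes r: "r \<ge> 2" and k: "k \<ge> 1" and \<epsilon>: "\<epsilon> > 0"
  shows "\<exists>N. \<forall>n\<ge>N. real (h_max n k (wheel (2 * r))) \<le> real (h_max n k (complete_graph 3)) + \<epsilon> * (real n)\<^sup>2"
proof -
  \<comment> \<open>The comparison is made for 2h. Sampling, samples with triangles and the leftover
    vertices of the blow-up each cost at most \<open>\<delta>\<close> times n^2; they are bounded
    together by four such errors, which make \<open>2 * \<epsilon>\<close> times n^2.\<close>
  define \<delta> where "\<delta> = \<epsilon> / 2"
  have \<delta>: "\<delta> > 0" using \<epsilon> by (simp add: \<delta>_def)
  obtain m :: nat where m: "m \<ge> 1"
    "\<And>V (E :: nat \<Rightarrow> nat \<Rightarrow> bool). finite V \<Longrightarrow> V \<noteq> {} \<Longrightarrow> (\<And>x y. E x y = E y x) \<Longrightarrow> (\<And>x. \<not> E x x) \<Longrightarrow>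
      min_mono_density V E k \<le> mean ({..<m} \<rightarrow>\<^sub>E V) (\<lambda>v. min_mono_density {..<m} (\<lambda>i j. E (v i) (v j)) k) + \<delta>"
    using sampling[OF k \<delta>] by blast
  define \<tau> where "\<tau> = \<delta> / real m ^ 3"
  have \<tau>: "\<tau> > 0" using \<delta> m(1) by (simp add: \<tau>_def)
  \<comment> \<open>The summands ensure, in this order, \<open>tri_dens V E \<le> \<tau>\<close>,
    \<open>2 * m \<le> \<delta> * n\<close> and \<open>m \<le> n\<close>.\<close>
  obtain N where N: "2 * (real r)\<^sup>2 / \<tau> ^ (r * r) + 2 * real m / \<delta> + real m < real N"
    using reals_Archimedean2 by blast
  show ?thesis
  proof (intro exI[of _ N] allI impI)
    fix n assume n: "n \<ge> N"
    have nonneg: "0 \<le> 2 * (real r)\<^sup>2 / \<tau> ^ (r * r)" "0 \<le> 2 * real m / \<delta>" using \<tau> \<delta> by auto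
    then have n1: "2 * (real r)\<^sup>2 / \<tau> ^ (r * r) \<le> real n" "2 * real m / \<delta> \<le> real n" "m \<le> n"
      using N n by linarith+
    have n0: "n > 0" using n1(3) m(1) by simp
    obtain G :: "nat ugraph" where G: "simple_graph G" "card (vertex_set G) = n" "H_free (wheel (2 * r)) G"
      "h_graph G k = h_max n k (wheel (2 * r))"
      using h_max_attained[OF k wheel_edges[of "2 * r"]] r by (metis (no_types, lifting) mult_pos_pos pos2 less_le_trans)
    define V where "V = vertex_set G"
    have V: "finite V" "V \<noteq> {}" using G n0 by (auto simp: V_def simple_graph_def)
    define E where "E = adj G"
    have sym: "E x y = E y x" for x y unfolding E_def by (rule adj_sym)
    have irr: "\<not> E x x" for x unfolding E_def by (rule adj_irrefl[OF G(1)])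
    define h where "h = real (h_max n k (complete_graph 3))"
    define S where "S = (\<lambda>v i j. E (v (i::nat)) (v j))"
    define tri where "tri = (\<lambda>v. \<exists>i<m. \<exists>j<m. \<exists>l<m. E (v i) (v j) \<and> E (v i) (v l) \<and> E (v j) (v l))"
    let ?P = "{..<m} \<rightarrow>\<^sub>E V"
    have P: "finite ?P" "?P \<noteq> {}" using V by (auto simp: finite_PiE PiE_eq_empty_iff)
    have fm: "finite {..<m}" "{..<m} \<noteq> {}" using m(1) by (auto simp: lessThan_empty_iff)
    have pt: "min_mono_density {..<m} (S v) k * (real n)\<^sup>2 \<le> (real n)\<^sup>2 * of_bool (tri v) + (2 * h + 2 * real n * real m)" for v
    proof -
      have mm1: "0 \<le> min_mono_density {..<m} (S v) k" "min_mono_density {..<m} (S v) k \<le> 1" using min_mono_density_bounds[OF fm(1) k] fm(2) by auto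
      show ?thesis
      proof (cases "tri v")
        case True
        have "min_mono_density {..<m} (S v) k * (real n)\<^sup>2 \<le> 1 * (real n)\<^sup>2" using mm1 by (intro mult_right_mono) auto
        moreover have "0 \<le> 2 * h + 2 * real n * real m" by (simp add: h_def)
        moreover have "(real n)\<^sup>2 * of_bool (tri v) = (real n)\<^sup>2" using True by simp
        ultimately show ?thesis by linarith
      next
        case False
        have "(real n - real (card {..<m}))\<^sup>2 * min_mono_density {..<m} (S v) k \<le> 2 * real (h_max n k (complete_graph 3)) \<or> n < card {..<m}"
        proof (rule blowup_h_max)
          show "S v x y = S v y x" for x y unfolding S_def by (rule sym)
          show "\<not> S v x x" for x unfolding S_def by (rule irr)
          fix x y z assume "x \<in> {..<m}" "y \<in> {..<m}" "z \<in> {..<m}"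
          then show "\<not> (S v x y \<and> S v y z \<and> S v x z)"
            using False unfolding tri_def S_def lessThan_iff by blast
        qed (use fm k in auto)
        then have "(real n - real m)\<^sup>2 * min_mono_density {..<m} (S v) k \<le> 2 * h" using n1(3) by (simp add: h_def)
        moreover have "((real n)\<^sup>2 - (real n - real m)\<^sup>2) * min_mono_density {..<m} (S v) k \<le> (2 * real n * real m) * 1"
        proof (rule mult_mono[OF _ mm1(2)])
          show "(real n)\<^sup>2 - (real n - real m)\<^sup>2 \<le> 2 * real n * real m" by (simp add: power2_diff)
        qed (use mm1 in auto)
        ultimately have "(real n)\<^sup>2 * min_mono_density {..<m} (S v) k \<le> 2 * h + 2 * real n * real m"
          by (simp add: left_diff_distrib)
        then show ?thesis using False by (simp add: mult.commute)
      qed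
    qed
    have "tri_dens V E ^ (r * r) \<le> 2 * (real r)\<^sup>2 / real n"
      using wheel_free_tri_dens[OF G(1) _ r G(3)] V G(2) by (simp add: V_def E_def)
    also have "\<dots> \<le> \<tau> ^ (r * r)" using n1(1) n0 \<tau> by (simp add: field_simps)
    finally have "tri_dens V E \<le> \<tau>"
      using \<tau> r by (intro power_le_imp_le_base[of "tri_dens V E" "r * r - 1" \<tau>]) auto
    then have "real m ^ 3 * tri_dens V E \<le> real m ^ 3 * \<tau>" by (intro mult_left_mono) auto
    also have "\<dots> = \<delta>" using m(1) by (simp add: \<tau>_def)
    finally have tri: "mean ?P (\<lambda>v. of_bool (tri v)) \<le> \<delta>"
      using mean_sample_triangle[OF V, where E = E and m = m, OF irr] unfolding tri_def by linarith
    have "min_mono_density V E k \<le> mean ?P (\<lambda>v. min_mono_density {..<m} (S v) k) + \<delta>"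
      unfolding S_def by (rule m(2)) (fact V sym irr)+
    then have "min_mono_density V E k * (real n)\<^sup>2 \<le> (mean ?P (\<lambda>v. min_mono_density {..<m} (S v) k) + \<delta>) * (real n)\<^sup>2"
      by (rule mult_right_mono) simp
    also have "\<dots> = mean ?P (\<lambda>v. min_mono_density {..<m} (S v) k * (real n)\<^sup>2) + \<delta> * (real n)\<^sup>2"
      by (simp add: mean_multc distrib_right)
    also have "mean ?P (\<lambda>v. min_mono_density {..<m} (S v) k * (real n)\<^sup>2) \<le>
       mean ?P (\<lambda>v. (real n)\<^sup>2 * of_bool (tri v) + (2 * h + 2 * real n * real m))" by (intro mean_mono pt)
    also have "\<dots> = (real n)\<^sup>2 * mean ?P (\<lambda>v. of_bool (tri v)) + (2 * h + 2 * real n * real m)"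
      by (simp only: mean_add mean_cmult mean_const[OF P])
    also have "(real n)\<^sup>2 * mean ?P (\<lambda>v. of_bool (tri v)) \<le> (real n)\<^sup>2 * \<delta>"
      using tri by (intro mult_left_mono) auto
    finally have 1: "min_mono_density V E k * (real n)\<^sup>2 \<le> 2 * h + 2 * real n * real m + 2 * (\<delta> * (real n)\<^sup>2)" by simp
    have "2 * real m \<le> \<delta> * real n" using n1(2) \<delta> by (simp add: field_simps)
    then have "2 * real m * real n \<le> \<delta> * real n * real n" by (intro mult_right_mono) auto
    then have "2 * real n * real m \<le> \<delta> * (real n)\<^sup>2" by (simp add: power2_eq_square ac_simps)
    moreover have "0 \<le> \<delta> * (real n)\<^sup>2" using \<delta> by simp
    ultimately have "min_mono_density V E k * (real n)\<^sup>2 \<le> 2 * h + 4 * (\<delta> * (real n)\<^sup>2)" using 1 by linarith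
    moreover have "2 * real (h_max n k (wheel (2 * r))) = min_mono_density V E k * (real n)\<^sup>2"
      using h_graph_eq[OF G(1) k] G(2,4) by (simp add: V_def E_def)
    ultimately show "real (h_max n k (wheel (2 * r))) \<le> real (h_max n k (complete_graph 3)) + \<epsilon> * (real n)\<^sup>2"
      by (simp add: \<delta>_def h_def)
  qed
qed

lemma wheel_edge:
  assumes "i < l"
  shows "{i, (i + 1) mod l} \<in> edge_set (wheel l)" "{i, l} \<in> edge_set (wheel l)"
  using assms unfolding wheel_def by auto

text \<open>The hub and two consecutive rim vertices form a triangle, so triangle-free graphs
  contain no wheel.\<close>

lemma h_max_K3_le_wheel:
  assumes "r \<ge> 2" "k \<ge> 1"
  shows "h_max n k (complete_graph 3) \<le> h_max n k (wheel (2 * r))"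
proof -
  obtain G :: "nat ugraph" where G: "simple_graph G" "card (vertex_set G) = n" "H_free (complete_graph 3) G"
      "h_graph G k = h_max n k (complete_graph 3)"
    using h_max_attained[OF assms(2), of "complete_graph 3"] by (auto simp: complete_graph_3)
  have "H_free (wheel (2 * r)) G"
    unfolding H_free_def
  proof
    assume "contains_graph G (wheel (2 * r))"
    then obtain f where "\<forall>e\<in>edge_set (wheel (2 * r)). f ` e \<in> edge_set G" unfolding contains_graph_def by blast
    moreover have "{0, 1} \<in> edge_set (wheel (2 * r))" "{0, 2 * r} \<in> edge_set (wheel (2 * r))"
        "{1, 2 * r} \<in> edge_set (wheel (2 * r))"
      using wheel_edge[of 0 "2 * r"] wheel_edge[of 1 "2 * r"] assms by simp_all
    ultimately have "f ` {0, 1} \<in> edge_set G" "f ` {0, 2 * r} \<in> edge_set G" "f ` {1, 2 * r} \<in> edge_set G" by blast+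
    then have "adj G (f 0) (f 1) \<and> adj G (f 1) (f (2 * r)) \<and> adj G (f 0) (f (2 * r))"
      by (simp add: adj_def)
    with G(3) show False unfolding K3_free_iff[OF G(1)] tri_free_def by blast
  qed
  then have "h_graph G k \<le> h_max n k (wheel (2 * r))"
    using G assms by (intro h_max_ge wheel_edges) auto
  with G(4) show ?thesis by simp
qed

section \<open>The upper bound\<close>

text \<open>Bernoulli's inequality \<open>1 + j * x \<le> (1 + x) ^ j\<close> together with
  \<open>(1 - x) * (1 + x) \<le> 1\<close>. Here \<open>x\<close> will be the relative degree of a
  vertex and \<open>(1 - x) ^ j\<close> the probability that \<open>j\<close> random neighbourhoods
  miss it.\<close>

lemma mult_power_one_minus_le:
  fixes x :: real
  assumes "0 \<le> x" "x \<le> 1"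
  shows "real j * (x * (1 - x) ^ j) \<le> 1"
proof -
  have "(1 - x) ^ j * (1 + real j * x) \<le> (1 - x) ^ j * (1 + x) ^ j"
    using assms Bernoulli_inequality[of x j] by (intro mult_left_mono) auto
  also have "\<dots> = ((1 - x) * (1 + x)) ^ j" by (simp add: power_mult_distrib)
  also have "\<dots> \<le> 1"
  proof (rule power_le_one)
    show "0 \<le> (1 - x) * (1 + x)" using assms by simp
    show "(1 - x) * (1 + x) \<le> 1" by (simp add: algebra_simps)
  qed
  finally have "(1 - x) ^ j + (1 - x) ^ j * (real j * x) \<le> 1" by (simp add: distrib_left)
  moreover have "0 \<le> (1 - x) ^ j" using assms by simp
  ultimately show ?thesis by (simp add: ac_simps)
qed

text \<open>In a triangle-free graph neighbourhoods are independent. Use the neighbourhoods of random vertices as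
  the first colour classes and distribute the remaining vertices uniformly over the remaining colours.\<close>

lemma min_mono_density_triangle_free_le:
  assumes V: "finite V" "V \<noteq> {}" and sym: "\<And>x y. E x y = E y x" and irr: "\<And>x. \<not> E x x"
    and tri: "\<And>x y z. \<not> (E x y \<and> E y z \<and> E x z)" and q: "q \<ge> 1"
  shows "real j * real q * min_mono_density V E (j + q) \<le> 1"
proof -
  let ?P = "{..<j} \<rightarrow>\<^sub>E V"
  have P: "finite ?P" "?P \<noteq> {}" using V by (auto simp: finite_PiE PiE_eq_empty_iff)
  define unc where "unc = (\<lambda>v u. \<forall>i<j. \<not> E u (v i))"
  define deg where "deg = (\<lambda>u. mean V (\<lambda>w. of_bool (E u w)))"
  have deg: "0 \<le> deg u" "deg u \<le> 1" for u
    unfolding deg_def using V by (auto intro!: mean_nonneg mean_le_const)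
  have col: "min_mono_density V E (j + q) \<le> mean V (\<lambda>u. of_bool (unc v u) * deg u) * (1 / real q)" for v
  proof -
    \<comment> \<open>The first random neighbourhood containing \<open>u\<close>; the value is used
      only where there is one.\<close>
    define c where "c = (\<lambda>u. LEAST i. i < j \<and> E u (v i))"
    have c: "c u < j \<and> E u (v (c u))" if "\<not> unc v u" for u
      unfolding c_def by (rule LeastI_ex[of "\<lambda>i. i < j \<and> E u (v i)"]) (use that in \<open>simp add: unc_def\<close>)
    define p where "p = (\<lambda>u a. if unc v u then of_bool (j \<le> a) / real q else (of_bool (a = c u) :: real))"
    have split: "(\<Sum>a<j + q. g a) = (\<Sum>a<j. g a) + (\<Sum>a\<in>{j..<j + q}. g a)" for g :: "nat \<Rightarrow> real"
      by (subst sum.union_disjoint[symmetric]) (auto intro!: sum.cong)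
    have unif: "(\<Sum>a<j + q. of_bool (j \<le> a) * x) = real q * x" for x :: real
      unfolding split by simp
    have "frac_colouring V (j + q) p"
      unfolding frac_colouring_def
    proof (intro ballI conjI allI impI)
      fix u assume "u \<in> V"
      show "0 \<le> p u a" for a by (simp add: p_def)
      show "(\<Sum>a<j + q. p u a) = 1"
      proof (cases "unc v u")
        case True
        then show ?thesis using unif[of "1 / real q"] q by (simp add: p_def)
      next
        case False
        then have "(\<Sum>a<j + q. p u a) = (\<Sum>a<j + q. of_bool (a = c u) * 1)" by (simp only: p_def if_False mult_1_right)
        also have "\<dots> = 1" using c[OF False] by (intro sum_delta_mult) auto
        finally show ?thesis .
      qed
    qed
    then have "min_mono_density V E (j + q) \<le> frac_cost V E (j + q) p" using V irr by (intro rounding) auto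
    \<comment> \<open>Only edges with both ends uncovered cost anything, namely
      \<open>1 / q\<close>. Dropping the condition on \<open>w\<close> leaves the degree of
      \<open>u\<close> as a factor.\<close>
    also have "\<dots> \<le> mean V (\<lambda>u. mean V (\<lambda>w. of_bool (unc v u) * of_bool (E u w) * (1 / real q)))"
      unfolding frac_cost_def
    proof (intro mean_mono)
      fix u w
      show "of_bool (E u w) * (\<Sum>a<j + q. p u a * p w a) \<le> of_bool (unc v u) * of_bool (E u w) * (1 / real q)"
      proof (cases "E u w")
        case E: True
        show ?thesis
        proof (cases "unc v u")
          case u: True
          show ?thesis
          proof (cases "unc v w")
            case True
            have "(\<Sum>a<j + q. p u a * p w a) = (\<Sum>a<j + q. of_bool (j \<le> a) * (1 / real q * (1 / real q)))"
              using u True by (intro sum.cong) (auto simp: p_def)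
            then show ?thesis using u E q unfolding unif by simp
          next
            case False
            have "p u a * p w a = 0" for a using u False c[OF False] by (auto simp: p_def)
            then have "(\<Sum>a<j + q. p u a * p w a) = 0" by (intro sum.neutral) blast
            then show ?thesis by (simp only: mult_zero_right) simp
          qed
        next
          case u: False
          have "p u a * p w a = 0" for a
          proof (cases "unc v w")
            case True
            then show ?thesis using u c[OF u] by (auto simp: p_def)
          next
            case False
            \<comment> \<open>Equal colours mean a common neighbour \<open>v (c u)\<close>, which
              closes a triangle with the edge from \<open>u\<close> to \<open>w\<close>.\<close>
            have "c u \<noteq> c w"
            proof
              assume "c u = c w"
              then have "E w (v (c u))" using c[OF False] by simp
              with E c[OF u] tri[of u w "v (c u)"] show False by blast
            qed
            then show ?thesis using u False by (auto simp: p_def)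
          qed
          then have "(\<Sum>a<j + q. p u a * p w a) = 0" by (intro sum.neutral) blast
          then show ?thesis by (simp only: mult_zero_right) simp
        qed
      qed simp
    qed
    also have "\<dots> = mean V (\<lambda>u. of_bool (unc v u) * deg u) * (1 / real q)"
      unfolding deg_def by (simp only: mean_cmult mean_multc)
    finally show ?thesis .
  qed
  have unc: "mean ?P (\<lambda>v. of_bool (unc v u)) = (1 - deg u) ^ j" for u
  proof -
    have "of_bool (unc v u) = (\<Prod>i<j. 1 - of_bool (E u (v i)) :: real)" for v
    proof (cases "unc v u")
      case True
      then show ?thesis by (auto simp: unc_def)
    next
      case False
      then obtain i where "i < j" "E u (v i)" by (auto simp: unc_def)
      then have "(\<Prod>i<j. 1 - of_bool (E u (v i)) :: real) = 0"
        by (intro prod_zero bexI[of _ i]) auto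
      then show ?thesis using False by (simp only: of_bool_eq)
    qed
    then have "mean ?P (\<lambda>v. of_bool (unc v u)) = mean V (\<lambda>w. 1 - of_bool (E u w)) ^ j"
      using mean_PiE_prod[of "{..<j}" V "\<lambda>w. 1 - of_bool (E u w)"] V by (simp only: card_lessThan finite_lessThan simp_thms)
    then show ?thesis unfolding deg_def mean_diff mean_const[OF V] .
  qed
  have "min_mono_density V E (j + q) = mean ?P (\<lambda>v. min_mono_density V E (j + q))" using P by (simp add: mean_const)
  also have "\<dots> \<le> mean ?P (\<lambda>v. mean V (\<lambda>u. of_bool (unc v u) * deg u) * (1 / real q))"
    by (intro mean_mono col)
  also have "\<dots> = mean V (\<lambda>u. (1 - deg u) ^ j * deg u) * (1 / real q)"
    by (simp only: mean_multc mean_swap[of ?P] unc)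
  finally have "min_mono_density V E (j + q) * real q \<le> mean V (\<lambda>u. (1 - deg u) ^ j * deg u)"
    using q by (simp add: field_simps)
  then have "real j * (min_mono_density V E (j + q) * real q) \<le> real j * mean V (\<lambda>u. (1 - deg u) ^ j * deg u)"
    by (rule mult_left_mono) simp
  also have "\<dots> = mean V (\<lambda>u. real j * (deg u * (1 - deg u) ^ j))"
    by (simp add: mean_cmult mult.commute)
  also have "\<dots> \<le> 1" using V deg by (intro mean_le_const mult_power_one_minus_le)
  finally show ?thesis by (simp add: ac_simps)
qed

text \<open>For \<open>k \<ge> 2\<close>, halving \<open>k\<close> into \<open>j\<close> and
  \<open>q\<close> gives \<open>j * q \<ge> k^2 / 6\<close>, hence density at most
  \<open>6 / k^2\<close>; ordered pairs turn 6 into 3.\<close>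

lemma h_max_K3_upper:
  assumes k: "k \<ge> 1"
  shows "real (h_max n k (complete_graph 3)) \<le> 3 * ((real n)\<^sup>2 / (real k)\<^sup>2)"
proof -
  obtain G :: "nat ugraph" where G: "simple_graph G" "card (vertex_set G) = n" "H_free (complete_graph 3) G"
      "h_graph G k = h_max n k (complete_graph 3)"
    using h_max_attained[OF k, of "complete_graph 3"] by (auto simp: complete_graph_3)
  define M where "M = min_mono_density (vertex_set G) (adj G) k"
  have fin: "finite (vertex_set G)" using G(1) by (simp add: simple_graph_def)
  have h: "2 * real (h_max n k (complete_graph 3)) = M * (real n)\<^sup>2"
    using h_graph_eq[OF G(1) k] G(2,4) by (simp add: M_def)
  show ?thesis
  proof (cases "n = 0")
    case False
    then have V: "vertex_set G \<noteq> {}" using G(2) by auto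
    have M: "0 \<le> M" "M \<le> 1" unfolding M_def using min_mono_density_bounds[OF fin k] V by auto
    have "M * (real k)\<^sup>2 \<le> 6"
    \<comment> \<open>Here \<open>k div 2 = 0\<close> would leave no random neighbourhoods, but the
      trivial bound 1 on the density suffices.\<close>
    proof (cases "k = 1")
      case True
      then show ?thesis using M by simp
    next
      case False
      define j where "j = k div 2"
      define q where "q = k - j"
      have jq: "k = j + q" "q \<ge> 1" using k by (auto simp: j_def q_def)
      have "k \<le> 3 * j" "k \<le> 2 * q" using k False by (auto simp: j_def q_def)
      then have "real k * real k \<le> real (3 * j) * real (2 * q)" by (intro mult_mono) auto
      then have "M * (real k)\<^sup>2 \<le> M * (6 * (real j * real q))"
        using M(1) by (intro mult_left_mono) (auto simp: power2_eq_square)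
      also have "\<dots> = 6 * (real j * real q * M)" by simp
      also have "real j * real q * M \<le> 1"
        unfolding M_def jq(1)
        by (rule min_mono_density_triangle_free_le[OF fin V adj_sym adj_irrefl[OF G(1)] _ jq(2)])
           (use G(3) in \<open>auto simp: K3_free_iff[OF G(1)] tri_free_def\<close>)
      finally show ?thesis by simp
    qed
    then have "M \<le> 6 / (real k)\<^sup>2" using k by (simp add: pos_le_divide_eq)
    then have "M * (real n)\<^sup>2 \<le> 6 / (real k)\<^sup>2 * (real n)\<^sup>2" by (rule mult_right_mono) simp
    then show ?thesis using h by simp
  qed (use h in simp)
qed

section \<open>Finite fields of characteristic two\<close>

lemma char_two: "(x :: bit alg_closure) + x = 0"
proof -
  have "(1 :: bit alg_closure) + 1 = to_ac (1 + 1)" by (simp only: to_ac_add to_ac_1)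
  then have "(1 :: bit alg_closure) + 1 = 0" by simp
  then have "x * (1 + 1) = 0" by (simp only: mult_zero_right)
  then show ?thesis by (simp only: distrib_left mult_1_right)
qed

lemma frobenius_add: "((x :: bit alg_closure) + y) ^ (2 ^ n) = x ^ (2 ^ n) + y ^ (2 ^ n)"
proof (induction n arbitrary: x y)
  case (Suc n)
  have sq: "(x + y) ^ 2 = x ^ 2 + y ^ 2"
    using char_two[of "x * y"] by (simp add: power2_eq_square algebra_simps)
  have "(x + y) ^ (2 ^ Suc n) = ((x + y) ^ 2) ^ (2 ^ n)" by (simp only: power_mult[symmetric] power_Suc)
  also have "\<dots> = (x ^ 2) ^ (2 ^ n) + (y ^ 2) ^ (2 ^ n)" unfolding sq by (rule Suc.IH)
  finally show ?case by (simp only: power_mult[symmetric] power_Suc)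
qed simp

text \<open>For \<open>n \<ge> 1\<close> the field with 2^n elements, as the fixed points of a power
  of Frobenius in the algebraic closure of the two-element field. As a subset of a field it inherits
  the field laws; what remains to check is closure under differences and products.\<close>

definition GF :: "nat \<Rightarrow> bit alg_closure set" where
  "GF n = {x. x ^ (2 ^ n) = x}"

lemma GF_diff: "x \<in> GF n \<Longrightarrow> y \<in> GF n \<Longrightarrow> x - y \<in> GF n"
proof -
  assume xy: "x \<in> GF n" "y \<in> GF n"
  have "- y = y" by (rule minus_unique) (rule char_two)
  then have eq: "x - y = x + y" by (simp only: diff_conv_add_uminus)
  show "x - y \<in> GF n" using xy unfolding eq GF_def by (simp add: frobenius_add)
qed

lemma GF_mult: "x \<in> GF n \<Longrightarrow> y \<in> GF n \<Longrightarrow> x * y \<in> GF n"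
  by (simp add: GF_def power_mult_distrib)

text \<open>The polynomial X^q - X has derivative -1, hence q distinct roots.\<close>

lemma card_GF:
  assumes n: "n \<ge> 1"
  shows "finite (GF n)" "card (GF n) = 2 ^ n"
proof -
  define q :: nat where "q = 2 ^ n"
  have q: "q \<ge> 2" using n power_increasing[of 1 n "2::nat"] by (simp add: q_def)
  define p :: "bit alg_closure poly" where "p = monom 1 q - monom 1 1"
  have deg: "degree p = q"
    unfolding p_def diff_conv_add_uminus using q by (subst degree_add_eq_left) (auto simp: degree_monom_eq)
  have p0: "p \<noteq> 0" using deg q by auto
  have root: "poly p x = 0 \<longleftrightarrow> x \<in> GF n" for x
    by (simp add: p_def poly_monom GF_def q_def)
  have "of_nat q = (0 :: bit alg_closure)"
  proof -
    have "even q" unfolding q_def using n by simp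
    then obtain i where "q = i + i" by (metis evenE mult_2)
    then show ?thesis by (simp only: of_nat_add char_two)
  qed
  then have pd: "pderiv p = [:-1:]"
    by (simp add: p_def pderiv_diff pderiv_monom monom_0)
  obtain A where A: "size A = degree p" "p = smult (lead_coeff p) (\<Prod>x\<in>#A. [:-x, 1:])"
    using alg_closed_imp_factorization[OF p0] by blast
  have simple: "count A x = 1" if "x \<in># A" for x
  proof (rule ccontr)
    assume "count A x \<noteq> 1"
    then have "2 \<le> count A x" using that by (simp add: Suc_le_eq numeral_2_eq_2 le_neq_implies_less)
    then have "replicate_mset 2 x \<subseteq># A" by (simp only: count_le_replicate_mset_subset_eq)
    then obtain C where C: "A = replicate_mset 2 x + C" by (metis subset_mset.le_iff_add)
    have "p = smult (lead_coeff p) ([:-x, 1:] * ([:-x, 1:] * (\<Prod>x\<in>#C. [:-x, 1:])))"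
      using A(2) unfolding C by (simp add: numeral_2_eq_2 mult.assoc)
    then have "p = [:-x, 1:] * ([:-x, 1:] * smult (lead_coeff p) (\<Prod>x\<in>#C. [:-x, 1:]))"
      by (simp only: mult_smult_right)
    then obtain s where s: "p = [:-x, 1:] * ([:-x, 1:] * s)" by blast
    define d where "d = [:-x, 1:]"
    have "poly d x = 0" by (simp add: d_def)
    then have "poly (pderiv (d * (d * s))) x = 0" by (simp add: pderiv_mult)
    then have "poly (pderiv p) x = 0" using s by (simp only: d_def)
    then show False by (simp add: pd)
  qed
  have "poly p x = 0 \<longleftrightarrow> x \<in># A" for x
  proof -
    have "poly p x = lead_coeff p * poly (\<Prod>x\<in>#A. [:-x, 1:]) x" by (subst A(2)) simp
    then show ?thesis using p0 by (auto simp: poly_prod_mset prod_mset_zero_iff)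
  qed
  then have GF: "GF n = set_mset A" using root by auto
  then show "finite (GF n)" by simp
  have "size A = (\<Sum>x\<in>set_mset A. count A x)" by (rule size_multiset_overloaded_eq)
  also have "\<dots> = card (set_mset A)" using simple by simp
  finally show "card (GF n) = 2 ^ n" using A(1) deg GF by (simp add: q_def)
qed

section \<open>Random bits rarely avoid split pairs\<close>

text \<open>In the application \<open>J\<close> consists of flags (point, direction),
  \<open>\<kappa>\<close> sends a flag to its line together with the colour of its point, and
  \<open>B\<close> is random. Orienting pairs from \<open>B\<close> to its complement counts each
  unordered pair once.\<close>

definition split_pairs :: "'i set \<Rightarrow> ('i \<Rightarrow> 'c) \<Rightarrow> 'i set \<Rightarrow> ('i \<times> 'i) set" where
  "split_pairs J \<kappa> B = {(x, y). x \<in> J \<and> y \<in> J \<and> \<kappa> x = \<kappa> y \<and> x \<in> B \<and> y \<notin> B}"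

lemma sum_Pow_insert:
  fixes f :: "'i set \<Rightarrow> real"
  assumes "finite Y" "x \<notin> Y"
  shows "(\<Sum>B\<in>Pow (insert x Y). f B) = (\<Sum>B\<in>Pow Y. f B + f (insert x B))"
proof -
  have "inj_on (insert x) (Pow Y)" using assms(2) by (intro inj_onI) (metis Pow_iff insert_ident subsetD)
  moreover have "Pow Y \<inter> insert x ` Pow Y = {}" using assms(2) by auto
  ultimately show ?thesis
    using assms(1) by (simp add: Pow_insert sum.union_disjoint sum.reindex sum.distrib)
qed

text \<open>Remove two elements of the same class: of the four ways to extend a set to them, two create
  a new split pair, and 1 + 1 + 1/8 + 1/8 = (3/2)^2.\<close>

lemma sum_split_pairs_le:
  assumes "finite J" "finite C" "\<kappa> ` J \<subseteq> C"
  shows "(\<Sum>B\<in>Pow J. (1 / 8 :: real) ^ card (split_pairs J \<kappa> B)) \<le> (4 / 3) ^ card C * (3 / 2) ^ card J"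
  using assms(1,3)
proof (induction "card J" arbitrary: J rule: less_induct)
  case less
  have finS: "finite (split_pairs J \<kappa> B)" for B
    by (rule finite_subset[of _ "J \<times> J"]) (use less.prems in \<open>auto simp: split_pairs_def\<close>)
  show ?case
  proof (cases "inj_on \<kappa> J")
    case True
    have "card J \<le> card C" using True less.prems assms(2) by (metis card_inj_on_le)
    have "(\<Sum>B\<in>Pow J. (1 / 8 :: real) ^ card (split_pairs J \<kappa> B)) \<le> (\<Sum>B\<in>Pow J. 1)"
      by (intro sum_mono power_le_one) auto
    \<comment> \<open>No pair shares a class any more; the unpaired elements, at most one per class,
      are what the factor \<open>4 / 3\<close> per class pays for.\<close>
    also have "\<dots> = (4 / 3 * (3 / 2)) ^ card J" using less.prems by (simp add: card_Pow)
    also have "\<dots> = (4 / 3) ^ card J * (3 / 2) ^ card J" by (rule power_mult_distrib)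
    also have "\<dots> \<le> (4 / 3) ^ card C * (3 / 2) ^ card J"
      using \<open>card J \<le> card C\<close> by (intro mult_right_mono power_increasing) auto
    finally show ?thesis .
  next
    case False
    then obtain x y where xy: "x \<in> J" "y \<in> J" "x \<noteq> y" "\<kappa> x = \<kappa> y" by (auto simp: inj_on_def)
    define Y where "Y = J - {x, y}"
    have Y: "J = insert x (insert y Y)" "x \<notin> insert y Y" "y \<notin> Y" "finite Y" "finite (insert y Y)"
      using xy less.prems by (auto simp: Y_def)
    have cJ: "card J = card Y + 2" unfolding Y(1) using Y by simp
    have le: "(1 / 8 :: real) ^ card (split_pairs J \<kappa> B') \<le> (1 / 8) ^ card (split_pairs Y \<kappa> B)"
      if "B' \<inter> Y = B" for B B'
    proof (rule power_decreasing)
      have "split_pairs Y \<kappa> B \<subseteq> split_pairs J \<kappa> B'" using that Y(1) by (auto simp: split_pairs_def)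
      then show "card (split_pairs Y \<kappa> B) \<le> card (split_pairs J \<kappa> B')" using finS by (intro card_mono)
    qed auto
    have lt: "(1 / 8 :: real) ^ card (split_pairs J \<kappa> B') \<le> (1 / 8) ^ card (split_pairs Y \<kappa> B) * (1 / 8)"
      if "B' \<inter> Y = B" "(u, w) \<in> split_pairs J \<kappa> B'" "u \<notin> Y" for B B' u w
    proof -
      have "insert (u, w) (split_pairs Y \<kappa> B) \<subseteq> split_pairs J \<kappa> B'"
        using that Y(1) by (auto simp: split_pairs_def)
      then have "card (insert (u, w) (split_pairs Y \<kappa> B)) \<le> card (split_pairs J \<kappa> B')"
        using finS by (intro card_mono)
      moreover have "(u, w) \<notin> split_pairs Y \<kappa> B" using that(3) by (auto simp: split_pairs_def)
      moreover have "finite (split_pairs Y \<kappa> B)"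
        by (rule finite_subset[of _ "Y \<times> Y"]) (use Y(4) in \<open>auto simp: split_pairs_def\<close>)
      ultimately have "Suc (card (split_pairs Y \<kappa> B)) \<le> card (split_pairs J \<kappa> B')" by simp
      then have "(1 / 8 :: real) ^ card (split_pairs J \<kappa> B') \<le> (1 / 8) ^ Suc (card (split_pairs Y \<kappa> B))"
        by (rule power_decreasing) auto
      then show ?thesis by simp
    qed
    have "(\<Sum>B\<in>Pow J. (1 / 8 :: real) ^ card (split_pairs J \<kappa> B)) =
      (\<Sum>B\<in>Pow Y. ((1 / 8) ^ card (split_pairs J \<kappa> B) + (1 / 8) ^ card (split_pairs J \<kappa> (insert x B))) +
       ((1 / 8) ^ card (split_pairs J \<kappa> (insert y B)) + (1 / 8) ^ card (split_pairs J \<kappa> (insert x (insert y B)))))"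
      (is "_ = ?R")
    proof -
      have "(\<Sum>B\<in>Pow J. (1 / 8 :: real) ^ card (split_pairs J \<kappa> B)) =
         (\<Sum>B\<in>Pow (insert x (insert y Y)). (1 / 8) ^ card (split_pairs J \<kappa> B))" by (subst Y(1)) (rule refl)
      also have "\<dots> = ?R"
        by (subst sum_Pow_insert[OF Y(5,2)], subst sum_Pow_insert[OF Y(4,3)]) (rule refl)
      finally show ?thesis .
    qed
    also have "\<dots> \<le> (\<Sum>B\<in>Pow Y. (1 / 8) ^ card (split_pairs Y \<kappa> B) * (9 / 4))"
    proof (rule sum_mono)
      fix B assume B: "B \<in> Pow Y"
      then have notin: "x \<notin> B" "y \<notin> B" and BY: "B \<inter> Y = B" "insert x B \<inter> Y = B" "insert y B \<inter> Y = B"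
        "insert x (insert y B) \<inter> Y = B" using Y(2,3) by auto
      have mem: "(x, y) \<in> split_pairs J \<kappa> (insert x B)" "(y, x) \<in> split_pairs J \<kappa> (insert y B)"
        using xy notin by (auto simp: split_pairs_def)
      have "x \<notin> Y" using Y(2) by simp
      show "((1 / 8 :: real) ^ card (split_pairs J \<kappa> B) + (1 / 8) ^ card (split_pairs J \<kappa> (insert x B))) +
       ((1 / 8) ^ card (split_pairs J \<kappa> (insert y B)) + (1 / 8) ^ card (split_pairs J \<kappa> (insert x (insert y B))))
       \<le> (1 / 8) ^ card (split_pairs Y \<kappa> B) * (9 / 4)"
        using le[OF BY(1)] le[OF BY(4)] lt[OF BY(2) mem(1) \<open>x \<notin> Y\<close>] lt[OF BY(3) mem(2) Y(3)] by linarith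
    qed
    also have "\<dots> = (\<Sum>B\<in>Pow Y. (1 / 8) ^ card (split_pairs Y \<kappa> B)) * (9 / 4)"
      by (simp only: sum_distrib_right)
    also have "\<dots> \<le> ((4 / 3) ^ card C * (3 / 2) ^ card Y) * (9 / 4)"
      using less.prems Y(1,4) cJ by (intro mult_right_mono less.hyps) auto
    also have "\<dots> = (4 / 3) ^ card C * (3 / 2) ^ card J" by (simp add: cJ power_add power2_eq_square)
    finally show ?thesis .
  qed
qed

section \<open>The lower bound\<close>

text \<open>The line through the point (x, u, w) in direction (1, y, y^2) is described by y and its point with x = 0.
  Three of these directions are linearly independent, so distinct lines never form a triangle.\<close>

definition line_of :: "'a \<times> 'a \<times> 'a \<Rightarrow> 'a \<Rightarrow> 'a \<times> 'a \<times> ('a :: field)" where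
  "line_of p y = (case p of (x, u, w) \<Rightarrow> (y, u - y * x, w - y * y * x))"

text \<open>A set of flags (p, y) splits every line into two parts; only pairs of points on a common line but in
  different parts are joined.\<close>

definition line_graph :: "'a set \<Rightarrow> (('a \<times> 'a \<times> 'a) \<times> 'a) set \<Rightarrow> 'a \<times> 'a \<times> 'a \<Rightarrow> 'a \<times> 'a \<times> ('a :: field) \<Rightarrow> bool" where
  "line_graph F B p p' \<longleftrightarrow> (\<exists>y\<in>F. line_of p y = line_of p' y \<and> ((p, y) \<in> B) \<noteq> ((p', y) \<in> B))"

lemma line_graph_sym: "line_graph F B p p' = line_graph F B p' p"
  unfolding line_graph_def by metis

lemma line_graph_irrefl: "\<not> line_graph F B p p"
  unfolding line_graph_def by blast

lemma line_of_eqD: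
  assumes "line_of (x, u, w) y = line_of (x', u', w') y"
  shows "u - u' = y * (x - x')" "w - w' = y * (y * (x - x'))"
  using assms by (simp_all add: line_of_def algebra_simps)

text \<open>Displacements along a line in direction \<open>y\<close> are multiples of
  \<open>(1, y, y^2)\<close>, so distinct points of it have distinct first coordinates and
  \<open>y\<close> is a quotient of coordinate differences.\<close>

lemma line_of_unique:
  assumes "line_of p y = line_of p' y" "line_of p z = line_of p' z" "p \<noteq> p'"
  shows "y = z"
proof -
  obtain x u w x' u' w' where p: "p = (x, u, w)" "p' = (x', u', w')" by (metis surj_pair)
  note 1 = line_of_eqD[OF assms(1)[unfolded p]] and 2 = line_of_eqD[OF assms(2)[unfolded p]]
  have "x \<noteq> x'"
  proof
    assume "x = x'"
    then have "u = u'" "w = w'" using 1 by simp_all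
    with \<open>x = x'\<close> p assms(3) show False by simp
  qed
  moreover have "y * (x - x') = z * (x - x')" by (rule trans[OF 1(1)[symmetric] 2(1)])
  ultimately show ?thesis by auto
qed

text \<open>The two equations are the last coordinates of
  \<open>(s + t) * (1, c, c^2) = s * (1, a, a^2) + t * (1, b, b^2)\<close>; this is Vandermonde for
  three points of the moment curve. Eliminating \<open>t\<close> gives
  \<open>(a - b) * (c - a) * s = 0\<close>.\<close>

lemma moment_curve_independent:
  fixes s t :: "'a :: field"
  assumes "s \<noteq> 0" "s + t \<noteq> 0" "c * (s + t) = a * s + b * t" "c * (c * (s + t)) = a * (a * s) + b * (b * t)"
  shows "a = c" "t \<noteq> 0 \<Longrightarrow> b = c"
proof -
  have 1: "(c - a) * s = (b - c) * t" using assms(3) by (simp add: algebra_simps)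
  have "(c + a) * ((c - a) * s) = (b + c) * ((b - c) * t)" using assms(4) by (simp add: algebra_simps)
  then have "(c + a) * ((c - a) * s) - (b + c) * ((c - a) * s) = 0" unfolding 1[symmetric] by simp
  moreover have "(c + a) * ((c - a) * s) - (b + c) * ((c - a) * s) = (a - b) * ((c - a) * s)"
    by (simp add: algebra_simps)
  ultimately have "(a - b) * ((c - a) * s) = 0" by simp
  then consider "a = b" | "a = c" using assms(1) by auto
  then show ac: "a = c"
  proof cases
    case 1
    then have "(c - a) * (s + t) = 0" using assms(3) by (simp add: algebra_simps)
    then show ?thesis using assms(2) by simp
  qed
  show "b = c" if "t \<noteq> 0" using 1 ac that by simp
qed

text \<open>The displacements along two sides add up to the third, so independence of the directions
  puts all three points on one line. There membership in \<open>B\<close> would have to differ for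
  all three pairs, which two truth values cannot do.\<close>

lemma line_graph_tri_free: "\<not> (line_graph F B p1 p2 \<and> line_graph F B p2 p3 \<and> line_graph F B p1 p3)"
proof
  assume "line_graph F B p1 p2 \<and> line_graph F B p2 p3 \<and> line_graph F B p1 p3"
  then obtain a b c where
    a: "line_of p1 a = line_of p2 a" "((p1, a) \<in> B) \<noteq> ((p2, a) \<in> B)" and
    b: "line_of p2 b = line_of p3 b" "((p2, b) \<in> B) \<noteq> ((p3, b) \<in> B)" and
    c: "line_of p1 c = line_of p3 c" "((p1, c) \<in> B) \<noteq> ((p3, c) \<in> B)"
    unfolding line_graph_def by metis
  obtain x1 u1 w1 x2 u2 w2 x3 u3 w3 where p: "p1 = (x1, u1, w1)" "p2 = (x2, u2, w2)" "p3 = (x3, u3, w3)"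
    by (metis surj_pair)
  note A = line_of_eqD[OF a(1)[unfolded p]] and Bq = line_of_eqD[OF b(1)[unfolded p]]
    and C = line_of_eqD[OF c(1)[unfolded p]]
  have s: "x1 - x2 \<noteq> 0"
  proof
    assume "x1 - x2 = 0"
    then have "p1 = p2" using A p by simp
    with a(2) show False by simp
  qed
  have t: "x2 - x3 \<noteq> 0"
  proof
    assume "x2 - x3 = 0"
    then have "p2 = p3" using Bq p by simp
    with b(2) show False by simp
  qed
  have st: "(x1 - x2) + (x2 - x3) = x1 - x3" by simp
  have st0: "x1 - x3 \<noteq> 0"
  proof
    assume "x1 - x3 = 0"
    then have "p1 = p3" using C p by simp
    with c(2) show False by simp
  qed
  have 1: "c * ((x1 - x2) + (x2 - x3)) = a * (x1 - x2) + b * (x2 - x3)"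
    unfolding st C(1)[symmetric] A(1)[symmetric] Bq(1)[symmetric] by simp
  have 2: "c * (c * ((x1 - x2) + (x2 - x3))) = a * (a * (x1 - x2)) + b * (b * (x2 - x3))"
    unfolding st C(2)[symmetric] A(2)[symmetric] Bq(2)[symmetric] by simp
  have "a = c" "b = c"
    using moment_curve_independent[OF s _ 1 2] st0 t unfolding st by blast+
  with a(2) b(2) c(2) show False by blast
qed

text \<open>Two distinct points share at most one line, so a split pair of flags is determined by
  its pair of points: forgetting the directions is injective.\<close>

lemma split_pairs_le_mono:
  assumes F: "finite F"
  defines "P \<equiv> F \<times> F \<times> F"
  shows "card (split_pairs (P \<times> F) (\<lambda>(p, y). (line_of p y, c p)) B) \<le>
    card {(p, p') \<in> P \<times> P. line_graph F B p p' \<and> c p = c p'}"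
proof (rule card_inj_on_le)
  let ?S = "split_pairs (P \<times> F) (\<lambda>(p, y). (line_of p y, c p)) B"
  let ?f = "\<lambda>(i, i'). (fst i, fst i')"
  have S: "y' = y \<and> p \<in> P \<and> p' \<in> P \<and> y \<in> F \<and> c p = c p' \<and> line_of p y = line_of p' y \<and>
      (p, y) \<in> B \<and> (p', y) \<notin> B" if "((p, y), (p', y')) \<in> ?S" for p y p' y'
    using that by (auto simp: split_pairs_def line_of_def split: prod.splits)
  show "inj_on ?f ?S"
  proof (rule inj_onI)
    fix i j assume ij: "i \<in> ?S" "j \<in> ?S" "?f i = ?f j"
    obtain p y p' y' where i: "i = ((p, y), (p', y'))" by (metis surj_pair)
    obtain r z r' z' where j: "j = ((r, z), (r', z'))" by (metis surj_pair)
    have eq: "r = p" "r' = p'" using ij(3) by (simp_all add: i j)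
    note Si = S[OF ij(1)[unfolded i]] and Sj = S[OF ij(2)[unfolded j eq]]
    have "p \<noteq> p'" using Si by blast
    then have "y = z" using Si Sj by (intro line_of_unique[of p y p' z]) auto
    then show "i = j" using Si Sj by (simp add: i j eq)
  qed
  show "?f ` ?S \<subseteq> {(p, p') \<in> P \<times> P. line_graph F B p p' \<and> c p = c p'}"
  proof
    fix e assume "e \<in> ?f ` ?S"
    then obtain i where "i \<in> ?S" "e = ?f i" by blast
    moreover obtain p y p' y' where "i = ((p, y), (p', y'))" by (metis surj_pair)
    ultimately have "((p, y), (p', y')) \<in> ?S" "e = (p, p')" by auto
    then show "e \<in> {(p, p') \<in> P \<times> P. line_graph F B p p' \<and> c p = c p'}"
      using S[of p y p' y'] unfolding line_graph_def by blast
  qed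
  have "{(p, p') \<in> P \<times> P. line_graph F B p p' \<and> c p = c p'} \<subseteq> P \<times> P" by auto
  then show "finite {(p, p') \<in> P \<times> P. line_graph F B p p' \<and> c p = c p'}"
    by (rule finite_subset) (simp add: P_def F)
qed

text \<open>Union bound over all colourings of the points.\<close>

lemma exists_splitting:
  fixes F :: "('a :: field) set"
  assumes F: "finite F" "card F = 16 * e" "\<And>x y. x \<in> F \<Longrightarrow> y \<in> F \<Longrightarrow> x - y \<in> F \<and> x * y \<in> F"
    and k: "k \<ge> 1" "k \<le> e"
  defines "P \<equiv> F \<times> F \<times> F"
  obtains B where "\<And>c. c \<in> P \<rightarrow>\<^sub>E {..<k} \<Longrightarrow>
    e * (16 * e) ^ 3 \<le> card (split_pairs (P \<times> F) (\<lambda>(p, y). (line_of p y, c p)) B)"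
proof (rule ccontr)
  assume no: "\<not> thesis"
  define Q where "Q = (16 * e) ^ 3"
  \<comment> \<open>One sixteenth of the q^4 flags, where q = 16e; on average \<open>e\<close> split
    pairs for each of the q^3 lines.\<close>
  define n where "n = e * Q"
  define Z where "Z = (\<lambda>c B. card (split_pairs (P \<times> F) (\<lambda>(p, y). (line_of p y, c p :: nat)) B))"
  let ?C = "P \<rightarrow>\<^sub>E {..<k}" and ?W = "Pow (P \<times> F)"
  have e: "e \<ge> 1" using k by simp
  have n0: "n > 0" using e by (simp add: n_def Q_def)
  have fin: "finite P" "finite (P \<times> F)" "finite ?C" using F(1) by (auto simp: P_def finite_PiE)
  have cP: "card P = Q" using F(2) by (simp add: P_def Q_def card_cartesian_product power3_eq_cube)
  have cPF: "card (P \<times> F) = 16 * n" using F(2) cP by (simp add: card_cartesian_product n_def)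
  have bad: "\<exists>c\<in>?C. Z c B < n" for B
  proof (rule ccontr)
    assume "\<not> ?thesis"
    then have "e * (16 * e) ^ 3 \<le> card (split_pairs (P \<times> F) (\<lambda>(p, y). (line_of p y, c p)) B)"
      if "c \<in> ?C" for c using that by (force simp: Z_def n_def Q_def)
    then show False using no that by blast
  qed
  have "(2::real) ^ (16 * n) = (\<Sum>B\<in>?W. 1)" using fin cPF by (simp add: card_Pow)
  \<comment> \<open>Exponential Markov inequality: for each \<open>B\<close> some colouring has
    fewer than \<open>n\<close> split pairs, and its term alone is at least 1.\<close>
  also have "\<dots> \<le> (\<Sum>B\<in>?W. \<Sum>c\<in>?C. 8 ^ n * (1 / 8) ^ Z c B)"
  proof (rule sum_mono)
    fix B
    obtain c where c: "c \<in> ?C" "Z c B < n" using bad by blast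
    have "(1::real) = 8 ^ n * (1 / 8) ^ n" by (simp add: power_mult_distrib[symmetric])
    also have "\<dots> \<le> 8 ^ n * (1 / 8) ^ Z c B" using c by (intro mult_left_mono power_decreasing) auto
    also have "\<dots> \<le> (\<Sum>c\<in>?C. 8 ^ n * (1 / 8) ^ Z c B)"
      using c fin by (intro member_le_sum[where f = "\<lambda>c. 8 ^ n * (1 / 8) ^ Z c B"]) auto
    finally show "(1::real) \<le> (\<Sum>c\<in>?C. 8 ^ n * (1 / 8) ^ Z c B)" .
  qed
  also have "\<dots> = (\<Sum>c\<in>?C. 8 ^ n * (\<Sum>B\<in>?W. (1 / 8) ^ Z c B))"
    by (subst sum.swap) (simp add: sum_distrib_left)
  also have "\<dots> \<le> (\<Sum>c\<in>?C. 8 ^ n * ((4 / 3) ^ n * (3 / 2) ^ (16 * n)))"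
  proof (intro sum_mono mult_left_mono)
    fix c assume c: "c \<in> ?C"
    have "(\<Sum>B\<in>?W. (1 / 8 :: real) ^ Z c B) \<le> (4 / 3) ^ card (P \<times> {..<k}) * (3 / 2) ^ card (P \<times> F)"
      unfolding Z_def
    proof (rule sum_split_pairs_le)
      \<comment> \<open>Closure of \<open>F\<close> puts the code of every line into
        \<open>P\<close>, so there are at most \<open>k * card P\<close> classes.\<close>
      show "(\<lambda>(p, y). (line_of p y, c p)) ` (P \<times> F) \<subseteq> P \<times> {..<k}"
        using c F(3) by (auto simp: P_def line_of_def PiE_iff)
    qed (use fin in auto)
    also have "card (P \<times> {..<k}) = k * Q" by (simp add: card_cartesian_product cP)
    also have "(4 / 3 :: real) ^ (k * Q) * (3 / 2) ^ card (P \<times> F) \<le> (4 / 3) ^ n * (3 / 2) ^ card (P \<times> F)"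
      using k by (intro mult_right_mono power_increasing) (auto simp: n_def)
    finally show "(\<Sum>B\<in>?W. (1 / 8 :: real) ^ Z c B) \<le> (4 / 3) ^ n * (3 / 2) ^ (16 * n)" by (simp only: cPF)
  qed simp
  also have "\<dots> = real (card ?C) * (8 ^ n * ((4 / 3) ^ n * (3 / 2) ^ (16 * n)))" by simp
  also have "\<dots> \<le> 2 ^ n * (8 ^ n * ((4 / 3) ^ n * (3 / 2) ^ (16 * n)))"
  proof (rule mult_right_mono)
    have "card ?C = k ^ Q" using fin cP by (simp add: card_PiE)
    also have "\<dots> \<le> (2 ^ e) ^ Q"
    proof (rule power_mono)
      show "k \<le> 2 ^ e" using k(2) less_exp[of e] by linarith
    qed simp
    finally have "card ?C \<le> 2 ^ n" by (simp add: n_def power_mult)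
    then have "real (card ?C) \<le> real (2 ^ n)" by (rule of_nat_mono)
    then show "real (card ?C) \<le> 2 ^ n" by (simp only: of_nat_power of_nat_numeral)
  qed simp
  also have "\<dots> = (2 * (8 * (4 / 3 * (3 / 2) ^ 16))) ^ n" by (simp only: power_mult_distrib power_mult)
  finally have le: "((2::real) ^ 16) ^ n \<le> (2 * (8 * (4 / 3 * (3 / 2) ^ 16))) ^ n" by (simp only: power_mult)
  \<comment> \<open>Divided by \<open>(3 / 2) ^ 16\<close>, the bases compare as
    \<open>64 / 3 < (4 / 3) ^ 16\<close>, about 21 against 99; the factor 16 between
    \<open>card F\<close> and \<open>e\<close> provides this room.\<close>
  have "((2 * (8 * (4 / 3 * (3 / 2) ^ 16))) :: real) ^ n < (2 ^ 16) ^ n"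
    by (rule power_strict_mono) (use n0 in \<open>auto simp: power_divide\<close>)
  with le show False by simp
qed

text \<open>\<open>e\<close> is the power of 2 with \<open>k < e \<le> 2 * k\<close>, and q = 16e is
  the field size. At least \<open>e * q^3\<close> monochromatic pairs among \<open>q^6\<close> give
  density at least \<open>1 / (2^12 * e^2)\<close>, hence at least
  \<open>1 / (2^14 * k^2)\<close>.\<close>

lemma triangle_free_lower:
  assumes k: "k \<ge> 1"
  obtains F B where "finite F" "F \<noteq> {}" "1 / (2 ^ 14 * (real k)\<^sup>2) \<le> min_mono_density (F \<times> F \<times> F) (line_graph (F :: bit alg_closure set) B) k"
proof -
  obtain i where i: "2 ^ i \<le> k" "k < 2 ^ (i + 1)" using ex_power_ivl1[of 2 k] k by auto
  define F where "F = GF (i + 5)"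
  define e :: nat where "e = 2 ^ (i + 1)"
  have F: "finite F" "card F = 16 * e" using card_GF[of "i + 5"] by (auto simp: F_def e_def power_add)
  have e: "k \<le> e" "e \<le> 2 * k" using i by (auto simp: e_def)
  have e0: "e > 0" using e k by simp
  have F_ops: "x - y \<in> F \<and> x * y \<in> F" if "x \<in> F" "y \<in> F" for x y
    using that by (simp add: F_def GF_diff GF_mult)
  obtain B where B: "\<And>c. c \<in> (F \<times> F \<times> F) \<rightarrow>\<^sub>E {..<k} \<Longrightarrow>
    e * (16 * e) ^ 3 \<le> card (split_pairs ((F \<times> F \<times> F) \<times> F) (\<lambda>(p, y). (line_of p y, c p)) B)"
  proof (rule exists_splitting[OF F _ k e(1)])
    show "x - y \<in> F \<and> x * y \<in> F" if "x \<in> F" "y \<in> F" for x y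
      using that by (rule F_ops)
  qed (rule that)
  define P where "P = F \<times> F \<times> F"
  have P: "finite P" "card P = (16 * e) ^ 3"
    using F by (auto simp: P_def card_cartesian_product power3_eq_cube)
  have "1 / (2 ^ 14 * (real k)\<^sup>2) \<le> mono_density P (line_graph F B) c" if c: "c \<in> P \<rightarrow>\<^sub>E {..<k}" for c
  proof -
    have "e * (16 * e) ^ 3 \<le> card {(p, p') \<in> P \<times> P. line_graph F B p p' \<and> c p = c p'}"
      using B[of c] c split_pairs_le_mono[OF F(1), of c B] by (simp add: P_def)
    then have "real (e * (16 * e) ^ 3) \<le> mono_density P (line_graph F B) c * (real (card P))\<^sup>2"
      unfolding mono_density_card[OF P(1)] by (simp only: of_nat_le_iff)
    then have "real (e * (16 * e) ^ 3) / (real ((16 * e) ^ 3))\<^sup>2 \<le> mono_density P (line_graph F B) c"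
      using e0 by (simp only: P(2)) (simp add: pos_divide_le_eq)
    moreover have "real (e * (16 * e) ^ 3) / (real ((16 * e) ^ 3))\<^sup>2 = 1 / (2 ^ 12 * (real e)\<^sup>2)"
      using e0 by (simp add: field_simps power2_eq_square power3_eq_cube)
    moreover have "1 / (2 ^ 14 * (real k)\<^sup>2) \<le> 1 / (2 ^ 12 * (real e)\<^sup>2)"
    proof (rule divide_left_mono)
      have "(real e)\<^sup>2 \<le> (2 * real k)\<^sup>2" using e(2) by (intro power_mono) auto
      then show "2 ^ 12 * (real e)\<^sup>2 \<le> 2 ^ 14 * (real k)\<^sup>2" by (simp add: power_mult_distrib)
    qed (use e0 k in auto)
    ultimately show ?thesis by linarith
  qed
  then have "1 / (2 ^ 14 * (real k)\<^sup>2) \<le> min_mono_density P (line_graph F B) k"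
    unfolding min_mono_density_def using P(1) k
    by (subst Min_ge_iff) (auto simp: finite_PiE PiE_eq_empty_iff lessThan_empty_iff)
  moreover have "F \<noteq> {}" using F(2) e0 by auto
  ultimately show ?thesis using that F(1) by (simp add: P_def)
qed

text \<open>\<open>2 ^ 17 = 2 ^ 14 * 2 * 4\<close>, with a factor 2 from ordered pairs and 4 from
  \<open>n - card P \<ge> n / 2\<close>.\<close>

lemma h_max_K3_lower:
  assumes k: "k \<ge> 1"
  shows "\<exists>N. \<forall>n\<ge>N. 1 / 2 ^ 17 * ((real n)\<^sup>2 / (real k)\<^sup>2) \<le> real (h_max n k (complete_graph 3))"
proof -
  obtain F B where F: "finite F" "F \<noteq> {}"
    and min_mono_density: "1 / (2 ^ 14 * (real k)\<^sup>2) \<le> min_mono_density (F \<times> F \<times> F) (line_graph (F :: bit alg_closure set) B) k"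
    using triangle_free_lower[OF k] .
  define P where "P = F \<times> F \<times> F"
  have P: "finite P" "P \<noteq> {}" using F by (auto simp: P_def)
  have "1 / 2 ^ 17 * ((real n)\<^sup>2 / (real k)\<^sup>2) \<le> real (h_max n k (complete_graph 3))" if n: "n \<ge> 2 * card P" for n
  proof -
    have "card P > 0" using P by (simp add: card_gt_0_iff)
    then have "\<not> n < card P" using n by simp
    then have "(real n - real (card P))\<^sup>2 * min_mono_density P (line_graph F B) k \<le> 2 * real (h_max n k (complete_graph 3))"
      using blowup_h_max[OF P, of "line_graph F B" k n] line_graph_sym line_graph_irrefl line_graph_tri_free k by blast
    moreover have "(real n / 2)\<^sup>2 * (1 / (2 ^ 14 * (real k)\<^sup>2)) \<le> (real n - real (card P))\<^sup>2 * min_mono_density P (line_graph F B) k"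
      using n min_mono_density unfolding P_def[symmetric] by (intro mult_mono power_mono) auto
    ultimately show ?thesis by (simp add: power_divide)
  qed
  then show ?thesis by blast
qed

theorem proposition4p6:
  shows "(\<forall>r\<ge>2. \<forall>k\<ge>1.
            (\<forall>n\<ge>1. h_max n k (complete_graph 3) \<le> h_max n k (wheel (2 * r))) \<and>
            (\<exists>\<epsilon> :: nat \<Rightarrow> real. \<epsilon> \<in> o(\<lambda>n. real n ^ 2) \<and>
               (\<forall>n\<ge>1. real (h_max n k (wheel (2 * r)))
                        \<le> real (h_max n k (complete_graph 3)) + \<epsilon> n))) \<and>
         (\<exists>c C :: real. c > 0 \<and> C > 0 \<and>
            (\<forall>r\<ge>2. \<forall>k\<ge>1. \<exists>N. \<forall>n\<ge>N.
               c * (real n ^ 2 / real k ^ 2) \<le> real (h_max n k (wheel (2 * r))) \<and>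
               real (h_max n k (wheel (2 * r))) \<le> C * (real n ^ 2 / real k ^ 2)))"
proof (intro conjI allI impI)
  fix r k n :: nat assume "r \<ge> 2" "k \<ge> 1"
  then show "h_max n k (complete_graph 3) \<le> h_max n k (wheel (2 * r))" by (rule h_max_K3_le_wheel)
next
  fix r k :: nat assume r: "r \<ge> 2" and k: "k \<ge> 1"
  define \<epsilon> where "\<epsilon> = (\<lambda>n. real (h_max n k (wheel (2 * r))) - real (h_max n k (complete_graph 3)))"
  have "\<epsilon> \<in> o(\<lambda>n. real n ^ 2)"
  proof (rule landau_o.smallI)
    fix c :: real assume "c > 0"
    then obtain N where N: "\<And>n. n \<ge> N \<Longrightarrow>
        real (h_max n k (wheel (2 * r))) \<le> real (h_max n k (complete_graph 3)) + c * (real n)\<^sup>2"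
      using h_max_wheel_le[OF r k] by blast
    show "\<forall>\<^sub>F n in at_top. norm (\<epsilon> n) \<le> c * norm (real n ^ 2)"
      using eventually_ge_at_top[of N]
    proof eventually_elim
      case (elim n)
      have "0 \<le> \<epsilon> n" using h_max_K3_le_wheel[OF r k, of n] by (simp add: \<epsilon>_def)
      then show ?case using N[OF elim] by (simp add: \<epsilon>_def)
    qed
  qed
  then show "\<exists>\<epsilon> :: nat \<Rightarrow> real. \<epsilon> \<in> o(\<lambda>n. real n ^ 2) \<and>
      (\<forall>n\<ge>1. real (h_max n k (wheel (2 * r))) \<le> real (h_max n k (complete_graph 3)) + \<epsilon> n)"
    by (intro exI[of _ \<epsilon>]) (simp add: \<epsilon>_def)
next
  have "\<exists>N. \<forall>n\<ge>N. 1 / 2 ^ 17 * (real n ^ 2 / real k ^ 2) \<le> real (h_max n k (wheel (2 * r))) \<and>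
      real (h_max n k (wheel (2 * r))) \<le> 4 * (real n ^ 2 / real k ^ 2)"
    if r: "r \<ge> 2" and k: "k \<ge> 1" for r k
  proof -
    \<comment> \<open>The error is taken as n^2 / k^2, which raises the upper constant from 3 to
      4.\<close>
    have "1 / (real k)\<^sup>2 > 0" using k by simp
    then obtain N1 where N1: "\<And>n. n \<ge> N1 \<Longrightarrow> real (h_max n k (wheel (2 * r))) \<le>
        real (h_max n k (complete_graph 3)) + 1 / (real k)\<^sup>2 * (real n)\<^sup>2"
      using h_max_wheel_le[OF r k] by blast
    obtain N2 where N2: "\<And>n. n \<ge> N2 \<Longrightarrow>
        1 / 2 ^ 17 * (real n ^ 2 / real k ^ 2) \<le> real (h_max n k (complete_graph 3))"
      using h_max_K3_lower[OF k] by blast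
    show ?thesis
    proof (intro exI[of _ "max N1 N2"] allI impI conjI)
      fix n assume n: "n \<ge> max N1 N2"
      have "real (h_max n k (complete_graph 3)) \<le> real (h_max n k (wheel (2 * r)))"
        using h_max_K3_le_wheel[OF r k] by (rule of_nat_mono)
      then show "1 / 2 ^ 17 * (real n ^ 2 / real k ^ 2) \<le> real (h_max n k (wheel (2 * r)))"
        using N2[of n] n by linarith
      have "1 / (real k)\<^sup>2 * (real n)\<^sup>2 = real n ^ 2 / real k ^ 2" by simp
      then show "real (h_max n k (wheel (2 * r))) \<le> 4 * (real n ^ 2 / real k ^ 2)"
        using N1[of n] n h_max_K3_upper[OF k, of n] by linarith
    qed
  qed
  then show "\<exists>c C :: real. c > 0 \<and> C > 0 \<and> (\<forall>r\<ge>2. \<forall>k\<ge>1. \<exists>N. \<forall>n\<ge>N.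
      c * (real n ^ 2 / real k ^ 2) \<le> real (h_max n k (wheel (2 * r))) \<and>
      real (h_max n k (wheel (2 * r))) \<le> C * (real n ^ 2 / real k ^ 2))"
    by (intro exI[of _ "1 / 2 ^ 17"] exI[of _ 4] conjI) simp_all
qed

end
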